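(* Consider the problem $\min_{x\in\Omega}P(x)=f(x)+h(x)$ with $f=\frac1n\sum_{i=1}^n f_i$, $\Omega\subseteq\mathbb{R}^d$ convex, $h$ convex (possibly nonsmooth), the $f_i$ possibly nonconvex, and let $x^*$ be an optimal solution. Suppose the algorithm Sparse-AsyLPG (described in the context) is run with $S$ epochs of $m$ inner iterations each, $T=Sm$, initial point $x^0$, gradient bit number $b$, model bit number $b_x$ and quantization constant $\mu>0$. Assume: (1) the index $a\in\{1,\dots,n\}$ sampled at each inner iteration satisfies $\mathbf{E}_a[\nabla f_a(x)]=\nabla f(x)$, and the random variables in different iterations are independent; (2) each $f_i$ is $L$-Lipschitz smooth: $\|\nabla f_i(x)-\nabla f_i(y)\|\le L\|x-y\|$ for all $x,y\in\Omega$; (3) the delay is bounded: $t-D(t)\le\tau$ for all $t$, for a finite constant $\tau>0$; (4) the sparsity budgets satisfy $\varphi_t\le\frac{\|\alpha_t\|_1}{\|\alpha_t\|_\infty}$, and the sparsification probabilities are $p_i=\frac{|\alpha_{t,i}|\,\varphi_t}{\|\alpha_t\|_1}$ for each $i\in\{1,\dots,d\}$. Let $\varphi=\min_t\{\varphi_t\}$, $\Gamma=\frac{d^2}{4\varphi(2^{b-1}-1)^2}+\frac d\varphi+1$, and let the step size be $\eta=\frac\rho L$, where $\rho\in(0,\frac12)$ and $\rho,\tau$ satisfy $$8\rho^2m^2(\mu+1)\Gamma+2\rho^2(\mu+1)\tau^2\Gamma+\rho\le1 .$$ Then the output $x_{out}$ of Sparse-AsyLPG satisfies $$\mathbf{E}\|G_\eta(x_{out})\|^2\le\frac{2L\,(P(x^0)-P(x^*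 ))}{\rho(1-2\rho)T},$$ where $G_\eta(x)=\frac1\eta\big[x-\mathrm{prox}_{\eta h}(x-\eta\nabla f(x))\big]$ is the gradient mapping.
   Context: Notation: $\|\cdot\|$ is the Euclidean norm, $\|\cdot\|_1$ the $L_1$ norm, $\|\cdot\|_\infty$ the max norm; $v_{t,i}$ is the $i$-th coordinate of $v_t$. $\mathrm{prox}_{\eta h}(x)=\arg\min_{y\in\Omega}\, h(y)+\frac{1}{2\eta}\|y-x\|^2$. $\mathbf{E}$ is expectation over all randomness of the algorithm. Quantization: for $\delta\ge 0$ and an integer $b\ge 2$, $\mathrm{dom}(\delta,b)=\{-2^{b-1}\delta,\dots,-\delta,0,\delta,\dots,(2^{b-1}-1)\delta\}$. For real $x$: if $x\in[z,z+\delta]$ with $z,z+\delta\in\mathrm{dom}(\delta,b)$, then $Q_{(\delta,b)}(x)=z+\delta$ with probability $\frac{x-z}{\delta}$ and $=z$ with probability $\frac{z+\delta-x}{\delta}$; otherwise $Q_{(\delta,b)}(x)$ is the point of $\mathrm{dom}(\delta,b)$ closest to $x$. (If $\delta=0$ it outputs $0$.) For a vector, each coordinate is quantized independently with the same $(\delta,b)$. Sparsification: given $\alpha_t\in\mathbb{R}^d$ and probabilities $p_1,\dots,p_d$ with $p_i\le1$, $\beta_t=\big[Z_1\frac{\alpha_{t,1}}{p_1},\dots,Z_d\frac{\alpha_{t,d}}{p_d}\big]$ with independent $Z_i\sim\mathrm{Bernoulli}(p_i)$; a coordinate with $\alpha_{t,i}=0$ gives $\beta_{t,i}=0$. The sparsity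 budget is $\varphi_t=\sum_{i=1}^dp_i>0$. Algorithm Sparse-AsyLPG. Set $\tilde x^0=x^0\in\Omega$. For $s=0,\dots,S-1$: set $x_0^{s+1}=\tilde x^s$ and compute the full gradient $\nabla f(\tilde x^s)$. For $t=0,\dots,m-1$: - An index $D(t)$ with $0\le D(t)\le t$ is given (asynchronous delay). With $\delta_x=\|x^{s+1}_{D(t)}\|_\infty/(2^{b_x-1}-1)$, form $Q_{(\delta_x,b_x)}(x^{s+1}_{D(t)})$; the quantization is required to satisfy $$\mathbf{E}_Q\|Q_{(\delta_x,b_x)}(x_{D(t)}^{s+1})-x_{D(t)}^{s+1}\|^2\le\mu\|x_{D(t)}^{s+1}-\tilde x^s\|^2,$$ where $\mathbf{E}_Q$ is over the quantization randomness. (If $x^{s+1}_{D(t)}=\tilde x^s$, the exact $\tilde x^s$ is used in place of the quantized vector, so the constraint holds.) - Sample $a\in\{1,\dots,n\}$ and compute $\alpha_t=\nabla f_a(Q_{(\delta_x,b_x)}(x^{s+1}_{D(t)}))-\nabla f_a(\tilde x^s)$. - Choose a sparsity budget $\varphi_t$ and sparsify $\alpha_t$ to obtain $\beta_t$. With $\delta_{\beta_t}=\|\beta_t\|_\infty/(2^{b-1}-1)$, set $\zeta_t=Q_{(\delta_{\beta_t},b)}(\beta_t)$. - Set $u_t^{s+1}=\zeta_t+\nabla f(\tilde x^s)$ and $x_{t+1}^{s+1}=\mathrm{prox}_{\eta h}(x_t^{s+1}-\eta u_t^{s+1})$. At the end of the epoch set $\tilde x^{s+1}=x_m^{s+1}$.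 The output $x_{out}$ is chosen uniformly at random from $\{x_t^{s+1}:0\le t\le m-1,\ 0\le s\le S-1\}$. The number $\varphi=\min_t\{\varphi_t\}$ is the smallest sparsity budget used. The quantized model vectors at which gradients are evaluated are treated as points of $\Omega$. *)

theory Defs
  imports "HOL-Probability.Probability"
begin

definition norm1 :: "real ^ 'd::finite \<Rightarrow> real" where
  "norm1 v = (\<Sum>i\<in>UNIV. \<bar>v $ i\<bar>)"

definition grad :: "('a::real_inner \<Rightarrow> real) \<Rightarrow> 'a \<Rightarrow> 'a" where
  "grad f x = (THE g. GDERIV f x :> g)"

definition average :: "nat \<Rightarrow> (nat \<Rightarrow> 'a \<Rightarrow> real) \<Rightarrow> 'a \<Rightarrow> real" where
  "average n f x = (1 / real n) * (\<Sum>i=1..n. f i x)"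

definition prox_objective :: "real \<Rightarrow> ('a::real_normed_vector \<Rightarrow> real) \<Rightarrow> 'a \<Rightarrow> 'a \<Rightarrow> real" where
  "prox_objective \<eta> h x y = h y + (1 / (2 * \<eta>)) * (norm (y - x))\<^sup>2"

definition prox :: "real \<Rightarrow> ('a::real_normed_vector \<Rightarrow> real) \<Rightarrow> 'a set \<Rightarrow> 'a \<Rightarrow> 'a" where
  "prox \<eta> h \<Omega> x = (ARG_MIN (prox_objective \<eta> h x) y. y \<in> \<Omega>)"

definition gradient_mapping ::
  "real \<Rightarrow> ('a::real_inner \<Rightarrow> real) \<Rightarrow> 'a set \<Rightarrow> ('a \<Rightarrow> real) \<Rightarrow> 'a \<Rightarrow> 'a" where
  "gradient_mapping \<eta> h \<Omega> F x = (1 / \<eta>) *\<^sub>R (x - prox \<eta> h \<Omega> (x - \<eta> *\<^sub>R grad F x))"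

definition quant_dom :: "real \<Rightarrow> nat \<Rightarrow> real set" where
  "quant_dom \<delta> b = {of_int k * \<delta> | k. - (2 ^ (b - 1)) \<le> k \<and> k \<le> 2 ^ (b - 1) - 1}"

(* If x is an interior grid point there are two admissible z; both give the point mass at x,
   so the choice made by SOME is immaterial. *)
definition quantize_real :: "real \<Rightarrow> nat \<Rightarrow> real \<Rightarrow> real pmf" where
  "quantize_real \<delta> b x =
     (if \<delta> = 0 then return_pmf 0
      else if \<exists>z. z \<in> quant_dom \<delta> b \<and> z + \<delta> \<in> quant_dom \<delta> b \<and> x \<in> {z..z + \<delta>}
      then let z = (SOME z. z \<in> quant_dom \<delta> b \<and> z + \<delta> \<in> quant_dom \<delta> b \<and> x \<in> {z..z + \<delta>})
           in map_pmf (\<lambda>up. if up then z + \<delta> else z) (bernoulli_pmf ((x - z) / \<delta>))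
      else return_pmf (ARG_MIN (\<lambda>y. \<bar>x - y\<bar>) y. y \<in> quant_dom \<delta> b))"

definition quantize :: "real \<Rightarrow> nat \<Rightarrow> real ^ 'd::finite \<Rightarrow> (real ^ 'd) pmf" where
  "quantize \<delta> b x = map_pmf vec_lambda (Pi_pmf UNIV 0 (\<lambda>i. quantize_real \<delta> b (x $ i)))"

definition quantize_max :: "nat \<Rightarrow> real ^ 'd::finite \<Rightarrow> (real ^ 'd) pmf" where
  "quantize_max b x = quantize (infnorm x / (2 ^ (b - 1) - 1)) b x"

definition sparsify :: "real ^ 'd::finite \<Rightarrow> real ^ 'd \<Rightarrow> (real ^ 'd) pmf" where
  "sparsify p \<alpha> =
     map_pmf (\<lambda>Z. \<chi> i. of_bool (Z i) * (\<alpha> $ i / p $ i))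
       (Pi_pmf UNIV False (\<lambda>i. bernoulli_pmf (p $ i)))"

(* Distribution of the point at which the sampled gradient is evaluated, given the stale iterate y
   and the snapshot xs. *)
definition model_point :: "nat \<Rightarrow> real ^ 'd::finite \<Rightarrow> real ^ 'd \<Rightarrow> (real ^ 'd) pmf" where
  "model_point bx y xs = (if y = xs then return_pmf xs else quantize_max bx y)"

(* Everything that happens in one inner iteration: x_t, the snapshot of the epoch, x_{D(t)}, the
   (quantized) point replacing x_{D(t)}, the sampled index a, alpha_t, the vector of sparsification
   probabilities, beta_t and zeta_t. *)
record ('d::finite) iteration =
  current :: "real ^ 'd"
  snapshot :: "real ^ 'd"
  stale :: "real ^ 'd"
  model :: "real ^ 'd"
  index :: nat
  alpha :: "real ^ 'd"
  probs :: "real ^ 'd"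
  beta :: "real ^ 'd"
  zeta :: "real ^ 'd"

definition budget :: "'d::finite iteration \<Rightarrow> real" where
  "budget e = (\<Sum>i\<in>UNIV. probs e $ i)"

(* A rule for choosing the sparsification probabilities may look at all iterations carried out so
   far (in every epoch) and at the current alpha_t. *)
type_synonym 'd selection = "'d iteration list \<Rightarrow> real ^ 'd \<Rightarrow> real ^ 'd"

(* ys lists the iterates x_0, ..., x_t of the current epoch (ys ! 0 is the snapshot), j = D(t) and
   A is the distribution of the sampled index. *)
definition perform_iteration ::
  "(nat \<Rightarrow> real ^ 'd \<Rightarrow> real) \<Rightarrow> nat \<Rightarrow> nat \<Rightarrow> 'd selection \<Rightarrow> nat pmf \<Rightarrow> nat
    \<Rightarrow> 'd iteration list \<Rightarrow> (real ^ 'd) list \<Rightarrow> ('d::finite iteration) pmf" where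
  "perform_iteration f bx b sel A j hist ys =
     do {
       let xs = ys ! 0;
       let y = ys ! j;
       w \<leftarrow> model_point bx y xs;
       a \<leftarrow> A;
       let \<alpha> = grad (f a) w - grad (f a) xs;
       let p = sel hist \<alpha>;
       \<beta> \<leftarrow> sparsify p \<alpha>;
       \<zeta> \<leftarrow> quantize_max b \<beta>;
       return_pmf \<lparr>current = last ys, snapshot = xs, stale = y, model = w, index = a,
                   alpha = \<alpha>, probs = p, beta = \<beta>, zeta = \<zeta>\<rparr>
     }"

definition next_iterate ::
  "nat \<Rightarrow> (nat \<Rightarrow> real ^ 'd \<Rightarrow> real) \<Rightarrow> (real ^ 'd \<Rightarrow> real) \<Rightarrow> (real ^ 'd) set \<Rightarrow> real
    \<Rightarrow> 'd::finite iteration \<Rightarrow> real ^ 'd" where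
  "next_iterate n f h \<Omega> \<eta> e =
     prox \<eta> h \<Omega> (current e - \<eta> *\<^sub>R (zeta e + grad (average n f) (snapshot e)))"

(* The first t inner iterations of an epoch with delays D and index distributions A, started with
   the history of all earlier epochs and the snapshot xs. *)
primrec epoch ::
  "nat \<Rightarrow> (nat \<Rightarrow> real ^ 'd \<Rightarrow> real) \<Rightarrow> (real ^ 'd \<Rightarrow> real) \<Rightarrow> (real ^ 'd) set \<Rightarrow> real
    \<Rightarrow> nat \<Rightarrow> nat \<Rightarrow> 'd selection \<Rightarrow> (nat \<Rightarrow> nat) \<Rightarrow> (nat \<Rightarrow> nat pmf)
    \<Rightarrow> 'd iteration list \<Rightarrow> real ^ 'd \<Rightarrow> nat
    \<Rightarrow> ('d::finite iteration list \<times> (real ^ 'd) list) pmf" where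
  "epoch n f h \<Omega> \<eta> bx b sel D A hist xs 0 = return_pmf (hist, [xs])"
| "epoch n f h \<Omega> \<eta> bx b sel D A hist xs (Suc t) =
     do {
       (hist', ys) \<leftarrow> epoch n f h \<Omega> \<eta> bx b sel D A hist xs t;
       e \<leftarrow> perform_iteration f bx b sel (A t) (D t) hist' ys;
       return_pmf (hist' @ [e], ys @ [next_iterate n f h \<Omega> \<eta> e])
     }"

(* Joint distribution of the history of all inner iterations of the first S epochs and the snapshot
   obtained after them; D s t and A s t belong to inner iteration t of epoch s. *)
primrec sparse_asylpg ::
  "nat \<Rightarrow> (nat \<Rightarrow> real ^ 'd \<Rightarrow> real) \<Rightarrow> (real ^ 'd \<Rightarrow> real) \<Rightarrow> (real ^ 'd) set \<Rightarrow> real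
    \<Rightarrow> nat \<Rightarrow> nat \<Rightarrow> 'd selection \<Rightarrow> (nat \<Rightarrow> nat \<Rightarrow> nat) \<Rightarrow> (nat \<Rightarrow> nat \<Rightarrow> nat pmf)
    \<Rightarrow> real ^ 'd \<Rightarrow> nat \<Rightarrow> nat
    \<Rightarrow> ('d::finite iteration list \<times> (real ^ 'd)) pmf" where
  "sparse_asylpg n f h \<Omega> \<eta> bx b sel D A x0 m 0 = return_pmf ([], x0)"
| "sparse_asylpg n f h \<Omega> \<eta> bx b sel D A x0 m (Suc s) =
     do {
       (hist, xs) \<leftarrow> sparse_asylpg n f h \<Omega> \<eta> bx b sel D A x0 m s;
       (hist', ys) \<leftarrow> epoch n f h \<Omega> \<eta> bx b sel (D s) (A s) hist xs m;
       return_pmf (hist', last ys)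
     }"

(* The history has length S * m; its entry s * m + t has x_t of epoch s as its current iterate. *)
definition sparse_asylpg_output ::
  "nat \<Rightarrow> (nat \<Rightarrow> real ^ 'd \<Rightarrow> real) \<Rightarrow> (real ^ 'd \<Rightarrow> real) \<Rightarrow> (real ^ 'd) set \<Rightarrow> real
    \<Rightarrow> nat \<Rightarrow> nat \<Rightarrow> 'd selection \<Rightarrow> (nat \<Rightarrow> nat \<Rightarrow> nat) \<Rightarrow> (nat \<Rightarrow> nat \<Rightarrow> nat pmf)
    \<Rightarrow> real ^ 'd \<Rightarrow> nat \<Rightarrow> nat \<Rightarrow> (real ^ 'd::finite) pmf" where
  "sparse_asylpg_output n f h \<Omega> \<eta> bx b sel D A x0 m S =
     do {
       (hist, xs) \<leftarrow> sparse_asylpg n f h \<Omega> \<eta> bx b sel D A x0 m S;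
       (s, t) \<leftarrow> pmf_of_set ({..<S} \<times> {..<m});
       return_pmf (current (hist ! (s * m + t)))
     }"

(* All inner iterations that occur with positive probability. *)
definition possible_iterations ::
  "nat \<Rightarrow> (nat \<Rightarrow> real ^ 'd \<Rightarrow> real) \<Rightarrow> (real ^ 'd \<Rightarrow> real) \<Rightarrow> (real ^ 'd) set \<Rightarrow> real
    \<Rightarrow> nat \<Rightarrow> nat \<Rightarrow> 'd selection \<Rightarrow> (nat \<Rightarrow> nat \<Rightarrow> nat) \<Rightarrow> (nat \<Rightarrow> nat \<Rightarrow> nat pmf)
    \<Rightarrow> real ^ 'd \<Rightarrow> nat \<Rightarrow> nat \<Rightarrow> ('d::finite iteration) set" where
  "possible_iterations n f h \<Omega> \<eta> bx b sel D A x0 m S =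
     (\<Union>(hist, xs) \<in> set_pmf (sparse_asylpg n f h \<Omega> \<eta> bx b sel D A x0 m S). set hist)"

end

(* Every random choice is made from a finite set, so all expectations are finite sums.
   Given the past, the compressed direction is unbiased once the sampled index is averaged out, and
   its mean square error is at most 2 L^2 (mu + 1) Gamma (|x_D(t) - x_t|^2 + |x_t - x_0|^2).
   A proximal step along an inexact gradient decreases P by a multiple of |G(x_t)|^2 and a multiple
   of |x_(t+1) - x_t|^2, up to eta / 2 times that error. Over an epoch both kinds of
   distances are sums of consecutive differences, and by Cauchy-Schwarz the error is bounded, along
   every single trajectory, by (tau^2 + m^2) times the sum of the |x_(t+1) - x_t|^2; the step size
   condition makes this no larger than the available decrease. *)

theory Submission
  imports Defs
begin

section \<open>Expectations over finitely supported distributions\<close>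

text \<open>The error of a step involves the stale iterate and the snapshot, so it cannot be charged
  to the decrease of that same step: the moves that pay for it lie in the past. Hence
  \<open>potential\<close> carries along the balance \<open>drift\<close> of moves made against
  errors incurred. In conditional expectation \<open>potential\<close> never increases, and
  nonnegativity of the balance is required only for a complete epoch, where it is a deterministic
  inequality about a list of vectors. A second obstacle is bias: gradients are sampled at a
  quantized point \<open>w\<close>, so the direction averages to the gradient at \<open>w\<close>,
  not at the current iterate. Compression and quantization therefore enter through identities for
  mean squares around a shifted centre, which cost no constant; the only factor 2 of the error bound
  comes from splitting the distance between stale iterate and snapshot at the current iterate.
  Finally, the hypotheses speak about iterations that occur in complete runs, while the induction
  meets partial ones; these have to be shown to be extendable.\<close>

lemma integrable_pmf_finite [simp]:
  fixes g :: "'a \<Rightarrow> 'b::{banach, second_countable_topology}"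
  shows "finite (set_pmf p) \<Longrightarrow> integrable (measure_pmf p) g"
  by (rule integrable_measure_pmf_finite)

lemma expectation_mono_finite:
  fixes g k :: "'a \<Rightarrow> real"
  assumes "finite (set_pmf p)" and "\<And>x. x \<in> set_pmf p \<Longrightarrow> g x \<le> k x"
  shows "measure_pmf.expectation p g \<le> measure_pmf.expectation p k"
  using assms by (intro integral_mono_AE) (auto simp: AE_measure_pmf_iff)

lemma expectation_cong:
  assumes "\<And>x. x \<in> set_pmf p \<Longrightarrow> g x = k x"
  shows "measure_pmf.expectation p g = measure_pmf.expectation p k"
  using assms by (intro integral_cong_AE) (auto simp: AE_measure_pmf_iff)

lemma expectation_bind_finite:
  fixes g :: "'b \<Rightarrow> 'c::{banach, second_countable_topology}"
  assumes "finite (set_pmf p)" and "\<And>x. x \<in> set_pmf p \<Longrightarrow> finite (set_pmf (f x))"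
  shows "measure_pmf.expectation (p \<bind> f) g =
    measure_pmf.expectation p (\<lambda>x. measure_pmf.expectation (f x) g)"
  using assms by (simp add: pmf_expectation_bind[of "set_pmf p"] integral_measure_pmf[of "set_pmf p"])

lemma expectation_norm_diff:
  fixes g :: "'a \<Rightarrow> 'b::euclidean_space"
  assumes "finite (set_pmf p)"
  shows "measure_pmf.expectation p (\<lambda>x. (norm (g x - c))\<^sup>2) =
    measure_pmf.expectation p (\<lambda>x. (norm (g x))\<^sup>2)
      - 2 * (measure_pmf.expectation p g \<bullet> c) + (norm c)\<^sup>2"
proof -
  have "(norm (g x - c))\<^sup>2 = (norm (g x))\<^sup>2 - 2 * (g x \<bullet> c) + (norm c)\<^sup>2" for x
    by (simp add: power2_norm_eq_inner algebra_simps inner_commute)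
  then show ?thesis using assms by simp
qed

text \<open>Bias-variance decomposition: the cross term vanishes because \<open>y\<close> is the
  mean. As an equality it adds the variance to the squared bias without any factor 2.\<close>

lemma expectation_norm_diff_mean:
  fixes g :: "'a \<Rightarrow> 'b::euclidean_space"
  assumes "finite (set_pmf p)" and "measure_pmf.expectation p g = y"
  shows "measure_pmf.expectation p (\<lambda>x. (norm (g x - c))\<^sup>2) =
    measure_pmf.expectation p (\<lambda>x. (norm (g x - y))\<^sup>2) + (norm (y - c))\<^sup>2"
  using assms by (simp add: expectation_norm_diff power2_norm_eq_inner algebra_simps inner_commute)

lemma expectation_Pi_pmf_component:
  fixes g :: "'b \<Rightarrow> 'c::{banach, second_countable_topology}"
  assumes "finite I" and "i \<in> I"
  shows "measure_pmf.expectation (Pi_pmf I dflt p) (\<lambda>X. g (X i)) = measure_pmf.expectation (p i) g"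
proof -
  have "measure_pmf.expectation (p i) g
      = measure_pmf.expectation (map_pmf (\<lambda>X. X i) (Pi_pmf I dflt p)) g"
    using assms by (simp only: Pi_pmf_component if_True)
  then show ?thesis by simp
qed

lemma finite_set_Pi_pmf:
  assumes "finite I" and "\<And>i. i \<in> I \<Longrightarrow> finite (set_pmf (p i))"
  shows "finite (set_pmf (Pi_pmf I dflt p))"
  using assms by (simp add: set_Pi_pmf finite_PiE_dflt)

lemma vec_expectation_nth:
  fixes g :: "'a \<Rightarrow> real ^ 'd::finite"
  assumes "finite (set_pmf p)"
  shows "measure_pmf.expectation p g $ i = measure_pmf.expectation p (\<lambda>x. g x $ i)"
  using integral_bounded_linear[OF bounded_linear_vec_nth, of "measure_pmf p" g i] assms by simp

lemma norm_vec_power2: "(norm (v :: real ^ 'd::finite))\<^sup>2 = (\<Sum>i\<in>UNIV. (v $ i)\<^sup>2)"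
  by (simp add: norm_vec_def L2_set_def sum_nonneg)

section \<open>Quantization and sparsification\<close>

text \<open>The range hypothesis keeps \<open>x\<close> between grid points, so the clipping branch
  is not reached. At an interior grid point \<open>SOME\<close> may return either adjacent cell;
  hence only some cell containing \<open>x\<close> is promised, which is enough for both
  moments.\<close>

lemma quantize_real_cell:
  assumes "b \<ge> 2" and "\<delta> > 0" and x: "\<bar>x\<bar> \<le> \<delta> * (2 ^ (b - 1) - 1)"
  obtains z where "x \<in> {z..z + \<delta>}"
    and "quantize_real \<delta> b x
      = map_pmf (\<lambda>up. if up then z + \<delta> else z) (bernoulli_pmf ((x - z) / \<delta>))"
proof -
  define K :: int where "K = 2 ^ (b - 1)"
  have "2 ^ 1 \<le> K" unfolding K_def using \<open>b \<ge> 2\<close> by (intro power_increasing) auto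
  then have K: "K \<ge> 2" by simp
  have KR: "real_of_int K = 2 ^ (b - 1)" by (simp add: K_def)
  have bds: "- (real_of_int K - 1) \<le> x / \<delta>" "x / \<delta> \<le> real_of_int K - 1"
    using x \<open>\<delta> > 0\<close> unfolding KR[symmetric] by (auto simp: field_simps abs_le_iff)
  \<comment> \<open>At the right end \<open>x / \<delta> = K - 1\<close> the floor would name a cell
    whose upper end lies outside the grid; the minimum with \<open>K - 2\<close> moves to the cell
    on its left.\<close>
  define k where "k = min \<lfloor>x / \<delta>\<rfloor> (K - 2)"
  have k1: "- K \<le> k" "k + 1 \<le> K - 1" using bds K unfolding k_def by (auto simp: le_floor_iff)
  have k2: "real_of_int k \<le> x / \<delta>" unfolding k_def by linarith
  have k3: "x / \<delta> \<le> real_of_int k + 1" using bds unfolding k_def min_def by (auto; linarith)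
  let ?C = "\<lambda>z. z \<in> quant_dom \<delta> b \<and> z + \<delta> \<in> quant_dom \<delta> b \<and> x \<in> {z..z + \<delta>}"
  have "?C (of_int k * \<delta>)"
  proof (intro conjI)
    show "of_int k * \<delta> \<in> quant_dom \<delta> b"
      unfolding quant_dom_def using k1 by (auto simp: K_def)
    show "of_int k * \<delta> + \<delta> \<in> quant_dom \<delta> b"
      unfolding quant_dom_def using k1
      by (intro CollectI exI[of _ "k + 1"]) (auto simp: K_def algebra_simps)
    show "x \<in> {of_int k * \<delta>..of_int k * \<delta> + \<delta>}"
      using k2 k3 \<open>\<delta> > 0\<close> by (auto simp: field_simps)
  qed
  then have ex: "\<exists>z. ?C z" by blast
  define z where "z = (SOME z. ?C z)"
  have "?C z" unfolding z_def by (rule someI_ex[OF ex])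
  moreover have "quantize_real \<delta> b x
      = map_pmf (\<lambda>up. if up then z + \<delta> else z) (bernoulli_pmf ((x - z) / \<delta>))"
    unfolding quantize_real_def using \<open>\<delta> > 0\<close> ex by (simp only: z_def Let_def if_True) simp
  ultimately show ?thesis using that by blast
qed

lemma finite_set_quantize_real: "finite (set_pmf (quantize_real \<delta> b x))"
  by (simp add: quantize_real_def Let_def)

lemma quantize_real_moments:
  assumes "b \<ge> 2" and "\<delta> \<ge> 0" and x: "\<bar>x\<bar> \<le> \<delta> * (2 ^ (b - 1) - 1)"
  shows "measure_pmf.expectation (quantize_real \<delta> b x) (\<lambda>q. q) = x"
    and "measure_pmf.expectation (quantize_real \<delta> b x) (\<lambda>q. (q - x)\<^sup>2) \<le> \<delta>\<^sup>2 / 4"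
proof -
  have "measure_pmf.expectation (quantize_real \<delta> b x) (\<lambda>q. q) = x \<and>
      measure_pmf.expectation (quantize_real \<delta> b x) (\<lambda>q. (q - x)\<^sup>2) \<le> \<delta>\<^sup>2 / 4"
  proof (cases "\<delta> = 0")
    case True
    with x show ?thesis by (simp add: quantize_real_def)
  next
    case False
    then have "\<delta> > 0" using assms by simp
    obtain z where z: "x \<in> {z..z + \<delta>}"
      and q: "quantize_real \<delta> b x
        = map_pmf (\<lambda>up. if up then z + \<delta> else z) (bernoulli_pmf ((x - z) / \<delta>))"
      using quantize_real_cell[OF assms(1) \<open>\<delta> > 0\<close> x] .
    \<comment> \<open>Relative position in the cell, which is also the probability of rounding up.
      The variance is \<open>\<delta>\<^sup>2 * (r * (1 - r))\<close>, and the maximum of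
      \<open>r * (1 - r)\<close> is the origin of the 4 in \<open>\<Gamma>\<close>.\<close>
    define r where "r = (x - z) / \<delta>"
    have r: "0 \<le> r" "r \<le> 1" "x = z + r * \<delta>" using z \<open>\<delta> > 0\<close> by (auto simp: r_def field_simps)
    have "r * (1 - r) \<le> 1 / 4"
      using zero_le_power2[of "r - 1 / 2"] by (simp add: power2_eq_square algebra_simps)
    then have "\<delta>\<^sup>2 * (r * (1 - r)) \<le> \<delta>\<^sup>2 * (1 / 4)" by (rule mult_left_mono) simp
    then show ?thesis unfolding q r_def[symmetric] using r
      by (simp add: power2_eq_square algebra_simps)
  qed
  then show "measure_pmf.expectation (quantize_real \<delta> b x) (\<lambda>q. q) = x"
    and "measure_pmf.expectation (quantize_real \<delta> b x) (\<lambda>q. (q - x)\<^sup>2) \<le> \<delta>\<^sup>2 / 4" by auto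
qed

lemma finite_set_quantize_max: "finite (set_pmf (quantize_max b x))"
  by (simp add: quantize_max_def quantize_def finite_set_Pi_pmf finite_set_quantize_real)

lemma finite_set_sparsify: "finite (set_pmf (sparsify p \<alpha>))"
  by (simp add: sparsify_def finite_set_Pi_pmf)

lemma two_le_levels: "b \<ge> 2 \<Longrightarrow> (2 :: real) ^ (b - 1) - 1 > 0"
  using power_increasing[of 1 "b - 1" "2::real"] by simp

text \<open>The width \<open>infnorm x / (2 ^ (b - 1) - 1)\<close> is the least one that keeps every
  coordinate in the range of \<open>quantize_real_moments\<close>: nothing is clipped, so rounding
  is unbiased, and each coordinate contributes at most a quarter of the squared width.\<close>

lemma
  fixes x :: "real ^ 'd::finite"
  assumes "b \<ge> 2"
  shows expectation_quantize_max: "measure_pmf.expectation (quantize_max b x) (\<lambda>q. q) = x"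
    and variance_quantize_max: "measure_pmf.expectation (quantize_max b x) (\<lambda>q. (norm (q - x))\<^sup>2)
      \<le> real CARD('d) * (infnorm x)\<^sup>2 / (4 * (2 ^ (b - 1) - 1)\<^sup>2)"
proof -
  define N :: real where "N = 2 ^ (b - 1) - 1"
  define \<delta> where "\<delta> = infnorm x / N"
  have N: "N > 0" using two_le_levels[OF assms] by (simp add: N_def)
  have \<delta>: "\<delta> \<ge> 0" using N by (simp add: \<delta>_def infnorm_pos_le)
  have x: "\<bar>x $ i\<bar> \<le> \<delta> * (2 ^ (b - 1) - 1)" for i
    unfolding \<delta>_def N_def[symmetric] using component_le_infnorm_cart[of x i] N by simp
  let ?Q = "Pi_pmf UNIV 0 (\<lambda>i. quantize_real \<delta> b (x $ i))"
  have q: "quantize_max b x = map_pmf vec_lambda ?Q"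
    by (simp add: quantize_max_def quantize_def \<delta>_def N_def)
  have fin: "finite (set_pmf ?Q)" by (simp add: finite_set_Pi_pmf finite_set_quantize_real)
  show "measure_pmf.expectation (quantize_max b x) (\<lambda>q. q) = x"
  proof (rule vec_eq_iff[THEN iffD2], rule allI)
    fix i
    have "measure_pmf.expectation (quantize_max b x) (\<lambda>q. q) $ i
        = measure_pmf.expectation ?Q (\<lambda>X. X i)"
      unfolding q by (simp add: vec_expectation_nth fin)
    also have "\<dots> = x $ i"
      using quantize_real_moments(1)[OF assms \<delta> x]
      by (simp add: expectation_Pi_pmf_component[where g = "\<lambda>q. q"])
    finally show "measure_pmf.expectation (quantize_max b x) (\<lambda>q. q) $ i = x $ i" .
  qed
  have "measure_pmf.expectation (quantize_max b x) (\<lambda>q. (norm (q - x))\<^sup>2)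
      = (\<Sum>i\<in>UNIV. measure_pmf.expectation ?Q (\<lambda>X. (X i - x $ i)\<^sup>2))"
    unfolding q by (simp add: norm_vec_power2 fin)
  also have "\<dots> \<le> (\<Sum>i\<in>(UNIV :: 'd set). \<delta>\<^sup>2 / 4)"
  proof (rule sum_mono)
    fix i
    show "measure_pmf.expectation ?Q (\<lambda>X. (X i - x $ i)\<^sup>2) \<le> \<delta>\<^sup>2 / 4"
      using quantize_real_moments(2)[OF assms \<delta> x]
      by (subst expectation_Pi_pmf_component[where i = i and g = "\<lambda>q. (q - x $ i)\<^sup>2"]) auto
  qed
  also have "\<dots> = real CARD('d) * (infnorm x)\<^sup>2 / (4 * (2 ^ (b - 1) - 1)\<^sup>2)"
    by (simp add: \<delta>_def N_def power_divide)
  finally show "measure_pmf.expectation (quantize_max b x) (\<lambda>q. (norm (q - x))\<^sup>2)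
      \<le> real CARD('d) * (infnorm x)\<^sup>2 / (4 * (2 ^ (b - 1) - 1)\<^sup>2)" .
qed

section \<open>Moments of sparsified vectors\<close>

lemma norm1_power2_le: "(norm1 (v :: real ^ 'd::finite))\<^sup>2 \<le> real CARD('d) * (norm v)\<^sup>2"
  using Cauchy_Schwarz_ineq_sum[of "\<lambda>i. \<bar>v $ i\<bar>" "\<lambda>_. 1" UNIV]
  by (simp add: norm1_def norm_vec_power2 mult.commute)

lemma norm1_pos: "v \<noteq> 0 \<Longrightarrow> 0 < norm1 v"
  unfolding norm1_def by (rule ccontr) (simp add: not_less sum_nonneg_eq_0_iff vec_eq_iff
      order_antisym_conv[OF sum_nonneg] abs_ge_zero)


text \<open>Dividing by \<open>p $ i\<close> undoes the thinning on average. Division by zero yields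
  0, so a coordinate with \<open>p $ i = 0\<close> is recovered only if it is itself 0; this is what
  \<open>supp\<close> ensures.\<close>

lemma expectation_sparsify:
  fixes \<alpha> p :: "real ^ 'd::finite"
  assumes p: "\<And>i. 0 \<le> p $ i" "\<And>i. p $ i \<le> 1" and supp: "\<And>i. \<alpha> $ i \<noteq> 0 \<Longrightarrow> p $ i \<noteq> 0"
  shows "measure_pmf.expectation (sparsify p \<alpha>) (\<lambda>\<beta>. \<beta>) = \<alpha>"
proof (rule vec_eq_iff[THEN iffD2], rule allI)
  fix i
  let ?Z = "Pi_pmf UNIV False (\<lambda>i. bernoulli_pmf (p $ i))"
  have fin: "finite (set_pmf ?Z)" by (simp add: finite_set_Pi_pmf)
  have "measure_pmf.expectation (sparsify p \<alpha>) (\<lambda>\<beta>. \<beta>) $ i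
      = measure_pmf.expectation ?Z (\<lambda>Z. of_bool (Z i) * (\<alpha> $ i / p $ i))"
    unfolding sparsify_def by (simp add: vec_expectation_nth fin)
  also have "\<dots> = \<alpha> $ i"
    using p[of i] supp[of i]
    by (subst expectation_Pi_pmf_component[where i = i and g = "\<lambda>z. of_bool z * (\<alpha> $ i / p $ i)"]) auto
  finally show "measure_pmf.expectation (sparsify p \<alpha>) (\<lambda>\<beta>. \<beta>) $ i = \<alpha> $ i" .
qed

text \<open>A nonzero coordinate contributes its square divided by its probability. For
  probabilities proportional to the absolute values this is linear in the absolute value, so the sum
  collapses to a second factor \<open>norm1 \<alpha>\<close>.\<close>

lemma expectation_norm_sparsify:
  fixes \<alpha> p :: "real ^ 'd::finite"
  assumes p: "\<And>i. 0 \<le> p $ i" "\<And>i. p $ i \<le> 1" and "\<phi> > 0"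
    and eq: "\<And>i. p $ i = \<bar>\<alpha> $ i\<bar> * \<phi> / norm1 \<alpha>" and "\<alpha> \<noteq> 0"
  shows "measure_pmf.expectation (sparsify p \<alpha>) (\<lambda>\<beta>. (norm \<beta>)\<^sup>2) = (norm1 \<alpha>)\<^sup>2 / \<phi>"
proof -
  let ?Z = "Pi_pmf UNIV False (\<lambda>i. bernoulli_pmf (p $ i))"
  have n1: "norm1 \<alpha> > 0" using \<open>\<alpha> \<noteq> 0\<close> by (rule norm1_pos)
  have fin: "finite (set_pmf ?Z)" by (simp add: finite_set_Pi_pmf)
  have "measure_pmf.expectation (sparsify p \<alpha>) (\<lambda>\<beta>. (norm \<beta>)\<^sup>2)
      = (\<Sum>i\<in>UNIV. measure_pmf.expectation ?Z (\<lambda>Z. (of_bool (Z i) * (\<alpha> $ i / p $ i))\<^sup>2))"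
    unfolding sparsify_def by (simp add: norm_vec_power2 fin)
  also have "\<dots> = (\<Sum>i\<in>UNIV. \<bar>\<alpha> $ i\<bar> * (norm1 \<alpha> / \<phi>))"
  proof (rule sum.cong[OF refl])
    fix i
    have "measure_pmf.expectation ?Z (\<lambda>Z. (of_bool (Z i) * (\<alpha> $ i / p $ i))\<^sup>2)
        = (\<alpha> $ i / p $ i)\<^sup>2 * p $ i"
      using p[of i] by (subst expectation_Pi_pmf_component
          [where i = i and g = "\<lambda>z. (of_bool z * (\<alpha> $ i / p $ i))\<^sup>2"]) auto
    also have "\<dots> = \<bar>\<alpha> $ i\<bar> * (norm1 \<alpha> / \<phi>)"
    proof (cases "\<alpha> $ i = 0")
      case False
      have "(\<alpha> $ i)\<^sup>2 = \<bar>\<alpha> $ i\<bar> * \<bar>\<alpha> $ i\<bar>" by (simp add: power2_eq_square)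
      with False n1 \<open>\<phi> > 0\<close> show ?thesis
        unfolding eq power_divide by (simp add: field_simps power2_eq_square)
    qed simp
    finally show "measure_pmf.expectation ?Z (\<lambda>Z. (of_bool (Z i) * (\<alpha> $ i / p $ i))\<^sup>2)
        = \<bar>\<alpha> $ i\<bar> * (norm1 \<alpha> / \<phi>)" .
  qed
  also have "\<dots> = (norm1 \<alpha>)\<^sup>2 / \<phi>"
    by (simp add: norm1_def sum_distrib_right[symmetric] sum_divide_distrib[symmetric] power2_eq_square)
  finally show ?thesis .
qed

text \<open>The law of \<open>zeta\<close> given \<open>alpha\<close> and the chosen probabilities,
  with \<open>beta\<close> integrated out.\<close>

definition compress :: "nat \<Rightarrow> real ^ 'd \<Rightarrow> real ^ 'd \<Rightarrow> (real ^ 'd::finite) pmf" where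
  "compress b p \<alpha> = sparsify p \<alpha> \<bind> quantize_max b"

lemma finite_set_compress: "finite (set_pmf (compress b p \<alpha>))"
  by (simp add: compress_def finite_set_sparsify finite_set_quantize_max)

text \<open>Given \<open>\<beta>\<close>, quantization adds at most
  \<open>c * (norm \<beta>)\<^sup>2\<close>, because
  \<open>infnorm \<beta> \<le> norm \<beta>\<close>; sparsification multiplies the second moment by
  at most \<open>d / \<phi>\<close>. The product \<open>(c + 1) * d / \<phi>\<close> is
  \<open>\<Gamma> - 1\<close>. The parameter \<open>\<phi>\<close> is a lower bound for the actual
  budget, so that one constant serves all iterations.\<close>

lemma
  fixes \<alpha> p :: "real ^ 'd::finite"
  assumes "b \<ge> 2" and p: "\<And>i. 0 \<le> p $ i" "\<And>i. p $ i \<le> 1" and "0 < \<phi>" and "\<phi> \<le> (\<Sum>i\<in>UNIV. p $ i)"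
    and eq: "\<And>i. \<alpha> \<noteq> 0 \<Longrightarrow> p $ i = \<bar>\<alpha> $ i\<bar> * (\<Sum>i\<in>UNIV. p $ i) / norm1 \<alpha>"
  shows expectation_compress: "measure_pmf.expectation (compress b p \<alpha>) (\<lambda>\<zeta>. \<zeta>) = \<alpha>"
    and expectation_norm_compress:
      "measure_pmf.expectation (compress b p \<alpha>) (\<lambda>\<zeta>. (norm \<zeta>)\<^sup>2)
        \<le> ((real CARD('d))\<^sup>2 / (4 * \<phi> * (2 ^ (b - 1) - 1)\<^sup>2) + real CARD('d) / \<phi>) * (norm \<alpha>)\<^sup>2"
proof -
  let ?\<phi>' = "\<Sum>i\<in>UNIV. p $ i" and ?d = "real CARD('d)"
  have supp: "p $ i \<noteq> 0" if "\<alpha> $ i \<noteq> 0" for i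
  proof -
    have "\<alpha> \<noteq> 0" using that by auto
    then have "p $ i = \<bar>\<alpha> $ i\<bar> * ?\<phi>' / norm1 \<alpha>" "norm1 \<alpha> > 0" by (auto intro: eq norm1_pos)
    with that \<open>0 < \<phi>\<close> \<open>\<phi> \<le> ?\<phi>'\<close> show "p $ i \<noteq> 0" by (metis abs_eq_0 divide_eq_0_iff less_irrefl mult_eq_0_iff order_less_le_trans)
  qed
  show "measure_pmf.expectation (compress b p \<alpha>) (\<lambda>\<zeta>. \<zeta>) = \<alpha>"
    using \<open>b \<ge> 2\<close> p supp
    by (simp add: compress_def expectation_bind_finite finite_set_sparsify finite_set_quantize_max
        expectation_quantize_max expectation_sparsify)
  define c where "c = ?d / (4 * (2 ^ (b - 1) - 1)\<^sup>2)"
  have "c \<ge> 0" by (simp add: c_def)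
  have sparse: "measure_pmf.expectation (sparsify p \<alpha>) (\<lambda>\<beta>. (norm \<beta>)\<^sup>2) \<le> ?d / \<phi> * (norm \<alpha>)\<^sup>2"
  proof (cases "\<alpha> = 0")
    \<comment> \<open>Here \<open>eq\<close> gives no information about \<open>p\<close>, but the
      zero vector is sparsified to itself for every \<open>p\<close>.\<close>
    case True
    have "(\<chi> i. 0) = (0 :: real ^ 'd)" by (simp add: vec_eq_iff)
    with True show ?thesis by (simp add: sparsify_def)
  next
    case False
    have "measure_pmf.expectation (sparsify p \<alpha>) (\<lambda>\<beta>. (norm \<beta>)\<^sup>2) = (norm1 \<alpha>)\<^sup>2 / ?\<phi>'"
      using p \<open>0 < \<phi>\<close> \<open>\<phi> \<le> ?\<phi>'\<close> False by (intro expectation_norm_sparsify eq) auto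
    also have "\<dots> \<le> ?d * (norm \<alpha>)\<^sup>2 / \<phi>"
      using \<open>0 < \<phi>\<close> \<open>\<phi> \<le> ?\<phi>'\<close> by (intro frac_le norm1_power2_le) auto
    finally show ?thesis by simp
  qed
  have "measure_pmf.expectation (compress b p \<alpha>) (\<lambda>\<zeta>. (norm \<zeta>)\<^sup>2)
      = measure_pmf.expectation (sparsify p \<alpha>)
          (\<lambda>\<beta>. measure_pmf.expectation (quantize_max b \<beta>) (\<lambda>\<zeta>. (norm \<zeta>)\<^sup>2))"
    by (simp add: compress_def expectation_bind_finite finite_set_sparsify finite_set_quantize_max)
  also have "\<dots> \<le> measure_pmf.expectation (sparsify p \<alpha>) (\<lambda>\<beta>. (c + 1) * (norm \<beta>)\<^sup>2)"
  proof (rule expectation_mono_finite[OF finite_set_sparsify])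
    fix \<beta> :: "real ^ 'd"
    have "measure_pmf.expectation (quantize_max b \<beta>) (\<lambda>\<zeta>. (norm \<zeta>)\<^sup>2)
        = measure_pmf.expectation (quantize_max b \<beta>) (\<lambda>\<zeta>. (norm (\<zeta> - \<beta>))\<^sup>2) + (norm \<beta>)\<^sup>2"
      using expectation_norm_diff_mean[OF finite_set_quantize_max expectation_quantize_max[OF \<open>b \<ge> 2\<close>],
          of \<beta> 0] by simp
    also have "\<dots> \<le> c * (infnorm \<beta>)\<^sup>2 + (norm \<beta>)\<^sup>2"
      using variance_quantize_max[OF \<open>b \<ge> 2\<close>, of \<beta>] by (simp add: c_def)
    also have "\<dots> \<le> c * (norm \<beta>)\<^sup>2 + (norm \<beta>)\<^sup>2"
      using \<open>c \<ge> 0\<close> by (intro add_mono mult_left_mono power_mono infnorm_le_norm infnorm_pos_le) auto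
    finally show "measure_pmf.expectation (quantize_max b \<beta>) (\<lambda>\<zeta>. (norm \<zeta>)\<^sup>2)
        \<le> (c + 1) * (norm \<beta>)\<^sup>2" by (simp add: algebra_simps)
  qed
  also have "\<dots> \<le> (c + 1) * (?d / \<phi> * (norm \<alpha>)\<^sup>2)"
    using mult_left_mono[OF sparse, of "c + 1"] \<open>c \<ge> 0\<close> by simp
  also have "\<dots> = (?d\<^sup>2 / (4 * \<phi> * (2 ^ (b - 1) - 1)\<^sup>2) + ?d / \<phi>) * (norm \<alpha>)\<^sup>2"
    by (simp add: c_def power2_eq_square algebra_simps)
  finally show "measure_pmf.expectation (compress b p \<alpha>) (\<lambda>\<zeta>. (norm \<zeta>)\<^sup>2)
      \<le> (?d\<^sup>2 / (4 * \<phi> * (2 ^ (b - 1) - 1)\<^sup>2) + ?d / \<phi>) * (norm \<alpha>)\<^sup>2" .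
qed

section \<open>Proximal steps along inexact gradients\<close>

lemma grad_eqI: "GDERIV f x :> g \<Longrightarrow> grad f x = g"
proof -
  assume g: "GDERIV f x :> g"
  have "g' = g" if "GDERIV f x :> g'" for g'
  proof -
    have "(\<lambda>h. h \<bullet> g') = (\<lambda>h. h \<bullet> g)"
      using that g has_derivative_unique unfolding gderiv_def by blast
    then show ?thesis by (metis inner_commute vector_eq_ldot)
  qed
  with g show ?thesis unfolding grad_def by blast
qed

text \<open>Riesz representation in coordinates: the values of the derivative on the basis are the
  coordinates of the gradient. This makes the definite description in \<open>grad\<close>
  usable.\<close>

lemma GDERIV_grad:
  fixes f :: "'a::euclidean_space \<Rightarrow> real"
  assumes "f differentiable (at x)"
  shows "GDERIV f x :> grad f x"
proof -
  obtain f' where f': "(f has_derivative f') (at x)" using assms by (auto simp: differentiable_def)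
  then have lin: "linear f'" by (rule has_derivative_linear)
  define g where "g = (\<Sum>i\<in>Basis. f' i *\<^sub>R i)"
  have "f' h = h \<bullet> g" for h
  proof -
    have "f' h = f' (\<Sum>i\<in>Basis. (h \<bullet> i) *\<^sub>R i)" by (simp add: euclidean_representation)
    also have "\<dots> = (\<Sum>i\<in>Basis. (h \<bullet> i) * f' i)"
      using lin by (simp add: linear_sum linear_cmul)
    also have "\<dots> = h \<bullet> g" by (simp add: g_def inner_sum_right mult.commute)
    finally show ?thesis .
  qed
  then have "f' = (\<lambda>h. h \<bullet> g)" by (rule ext)
  with f' have "GDERIV f x :> g" by (simp add: gderiv_def)
  with grad_eqI[OF this] show ?thesis by simp
qed

lemma GDERIV_average:
  fixes f :: "nat \<Rightarrow> 'a::euclidean_space \<Rightarrow> real"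
  assumes "\<And>i. i \<in> {1..n} \<Longrightarrow> f i differentiable (at x)"
  shows "GDERIV (average n f) x :> (1 / real n) *\<^sub>R (\<Sum>i=1..n. grad (f i) x)"
  unfolding gderiv_def average_def
  using GDERIV_grad[OF assms] unfolding gderiv_def
  by (intro has_derivative_eq_rhs[OF has_derivative_mult_right[OF has_derivative_sum]])
    (auto simp: inner_sum_right)

lemma grad_average:
  fixes f :: "nat \<Rightarrow> 'a::euclidean_space \<Rightarrow> real"
  assumes "\<And>i. i \<in> {1..n} \<Longrightarrow> f i differentiable (at x)"
  shows "grad (average n f) x = (1 / real n) *\<^sub>R (\<Sum>i=1..n. grad (f i) x)"
  using assms by (intro grad_eqI GDERIV_average)

lemma grad_average_Lipschitz:
  fixes f :: "nat \<Rightarrow> 'a::euclidean_space \<Rightarrow> real"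
  assumes "n \<ge> 1"
    and "\<And>i. i \<in> {1..n} \<Longrightarrow> f i differentiable (at x)"
    and "\<And>i. i \<in> {1..n} \<Longrightarrow> f i differentiable (at y)"
    and "\<And>i. i \<in> {1..n} \<Longrightarrow> norm (grad (f i) x - grad (f i) y) \<le> K"
  shows "norm (grad (average n f) x - grad (average n f) y) \<le> K"
proof -
  have "grad (average n f) x - grad (average n f) y
      = (1 / real n) *\<^sub>R (\<Sum>i=1..n. grad (f i) x - grad (f i) y)"
    by (simp only: grad_average[OF assms(2)] grad_average[OF assms(3)] sum_subtractf scaleR_diff_right)
  moreover have "norm (\<Sum>i=1..n. grad (f i) x - grad (f i) y) \<le> (\<Sum>i=1..n. K)"
    by (rule order_trans[OF norm_sum sum_mono]) (use assms in auto)
  ultimately show ?thesis using \<open>n \<ge> 1\<close> by (simp add: field_simps)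
qed

locale smooth_on =
  fixes F :: "'a::euclidean_space \<Rightarrow> real" and \<Omega> :: "'a set" and L :: real
  assumes domain_convex: "convex \<Omega>"
    and has_grad: "x \<in> \<Omega> \<Longrightarrow> GDERIV F x :> grad F x"
    and grad_Lipschitz: "x \<in> \<Omega> \<Longrightarrow> y \<in> \<Omega> \<Longrightarrow> norm (grad F x - grad F y) \<le> L * norm (x - y)"
begin

text \<open>Restricted to the segment from \<open>x\<close> to \<open>y\<close>, which stays in
  \<Omega> by convexity, \<open>F\<close> minus its linear part and minus or plus
  \<open>L * t\<^sup>2 / 2 * ?N\<close> is monotone, since the derivative of \<open>F\<close>
  deviates from its initial value by at most \<open>L * t * ?N\<close>. Without convexity of
  \<open>F\<close> the lower bound needs the quadratic term as well.\<close>

lemma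
  assumes x: "x \<in> \<Omega>" and y: "y \<in> \<Omega>"
  shows taylor_upper: "F y \<le> F x + grad F x \<bullet> (y - x) + L / 2 * (norm (y - x))\<^sup>2"
    and taylor_lower: "F x + grad F x \<bullet> (y - x) \<le> F y + L / 2 * (norm (y - x))\<^sup>2"
proof -
  let ?z = "\<lambda>t. x + t *\<^sub>R (y - x)"
  let ?N = "(norm (y - x))\<^sup>2"
  have z: "?z t \<in> \<Omega>" if "0 \<le> t" "t \<le> 1" for t
  proof -
    have "(1 - t) *\<^sub>R x + t *\<^sub>R y \<in> \<Omega>" using domain_convex x y that by (rule convexD_alt)
    then show ?thesis by (simp add: algebra_simps)
  qed
  have der: "((\<lambda>t. F (?z t)) has_real_derivative grad F (?z t) \<bullet> (y - x)) (at t)"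
    if "0 \<le> t" "t \<le> 1" for t
  proof -
    have "(F has_derivative (\<lambda>h. h \<bullet> grad F (?z t))) (at (?z t))"
      using has_grad[OF z[OF that]] by (simp add: gderiv_def)
    moreover have "(?z has_derivative (\<lambda>h. h *\<^sub>R (y - x))) (at t)"
      by (auto intro!: derivative_eq_intros)
    ultimately have "((\<lambda>t. F (?z t)) has_derivative (\<lambda>h. (h *\<^sub>R (y - x)) \<bullet> grad F (?z t))) (at t)"
      by (rule has_derivative_compose[rotated])
    then show ?thesis
      by (simp add: has_field_derivative_def inner_commute mult.commute[of _ "_ \<bullet> _"] lambda_one)
  qed
  have dev: "\<bar>(grad F (?z t) - grad F x) \<bullet> (y - x)\<bar> \<le> L * t * ?N" if "0 \<le> t" "t \<le> 1" for t
  proof -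
    have "\<bar>(grad F (?z t) - grad F x) \<bullet> (y - x)\<bar> \<le> norm (grad F (?z t) - grad F x) * norm (y - x)"
      by (rule Cauchy_Schwarz_ineq2)
    also have "\<dots> \<le> L * norm (?z t - x) * norm (y - x)"
      by (intro mult_right_mono grad_Lipschitz z that x) simp
    finally show ?thesis using that by (simp add: power2_eq_square mult_ac)
  qed
  let ?u = "\<lambda>t. F (?z t) - t * (grad F x \<bullet> (y - x)) - L * t\<^sup>2 / 2 * ?N"
  have "?u 1 \<le> ?u 0"
  proof (rule DERIV_nonpos_imp_nonincreasing[of 0 1])
    fix t :: real assume t: "0 \<le> t" "t \<le> 1"
    have "(?u has_real_derivative
        grad F (?z t) \<bullet> (y - x) - grad F x \<bullet> (y - x) - L * t * ?N) (at t)"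
      by (rule derivative_eq_intros der t refl | simp)+
    moreover have "grad F (?z t) \<bullet> (y - x) - grad F x \<bullet> (y - x) - L * t * ?N \<le> 0"
      using dev[OF t] by (simp add: inner_diff_left)
    ultimately show "\<exists>D. (?u has_real_derivative D) (at t) \<and> D \<le> 0" by blast
  qed simp
  then show "F y \<le> F x + grad F x \<bullet> (y - x) + L / 2 * ?N" by simp
  let ?l = "\<lambda>t. F (?z t) - t * (grad F x \<bullet> (y - x)) + L * t\<^sup>2 / 2 * ?N"
  have "?l 0 \<le> ?l 1"
  proof (rule DERIV_nonneg_imp_nondecreasing[of 0 1])
    fix t :: real assume t: "0 \<le> t" "t \<le> 1"
    have "(?l has_real_derivative
        grad F (?z t) \<bullet> (y - x) - grad F x \<bullet> (y - x) + L * t * ?N) (at t)"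
      by (rule derivative_eq_intros der t refl | simp)+
    moreover have "grad F (?z t) \<bullet> (y - x) - grad F x \<bullet> (y - x) + L * t * ?N \<ge> 0"
      using dev[OF t] by (simp add: inner_diff_left)
    ultimately show "\<exists>D. (?l has_real_derivative D) (at t) \<and> 0 \<le> D" by blast
  qed simp
  then show "F x + grad F x \<bullet> (y - x) \<le> F y + L / 2 * ?N" by simp
qed

end

section \<open>Proximal steps compared with arbitrary feasible points\<close>

locale proximal =
  fixes h :: "'a::euclidean_space \<Rightarrow> real" and \<Omega> :: "'a set" and \<eta> :: real
  assumes step_pos: "\<eta> > 0"
    and h_convex: "convex_on \<Omega> h"
    and prox_exists: "\<exists>y. is_arg_min (prox_objective \<eta> h x) (\<lambda>y. y \<in> \<Omega>) y"
begin

lemma prox_is_arg_min: "is_arg_min (prox_objective \<eta> h x) (\<lambda>y. y \<in> \<Omega>) (prox \<eta> h \<Omega> x)"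
  unfolding prox_def arg_min_def by (rule someI_ex[OF prox_exists])

lemma prox_in: "prox \<eta> h \<Omega> x \<in> \<Omega>"
  using prox_is_arg_min[of x] by (simp add: is_arg_min_def)

text \<open>The objective of the proximal problem is strongly convex with modulus \<open>1/\<eta>\<close>, which
  strengthens minimality by a quadratic term.\<close>

lemma prox_objective_gap:
  assumes z: "z \<in> \<Omega>"
  shows "prox_objective \<eta> h v (prox \<eta> h \<Omega> v) + (norm (z - prox \<eta> h \<Omega> v))\<^sup>2 / (2 * \<eta>)
    \<le> prox_objective \<eta> h v z"
proof -
  let ?y = "prox \<eta> h \<Omega> v"
  define c where "c = 1 / (2 * \<eta>)"
  have c: "c > 0" using step_pos by (simp add: c_def)
  have obj: "prox_objective \<eta> h v w = h w + c * (norm (w - v))\<^sup>2" for w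
    by (simp add: prox_objective_def c_def)
  let ?A = "prox_objective \<eta> h v ?y" and ?B = "prox_objective \<eta> h v z"
  \<comment> \<open>Minimality is tested at a point a fraction \<open>t\<close> of the way from
    \<open>?y\<close> to \<open>z\<close>; after division by \<open>t\<close> the quadratic gain has
    the factor \<open>s = 1 - t\<close>. The rule replaces the limit \<open>t\<close> to 0: it
    suffices to have the bound for every \<open>s\<close> below 1.\<close>
  have "c * (norm (z - ?y))\<^sup>2 \<le> ?B - ?A"
  proof (rule field_le_mult_one_interval)
    fix s :: real assume s: "0 < s" "s < 1"
    define t where "t = 1 - s"
    have t: "0 < t" "t < 1" using s by (auto simp: t_def)
    let ?w = "(1 - t) *\<^sub>R ?y + t *\<^sub>R z"
    have w: "?w \<in> \<Omega>"
      using h_convex t prox_in z by (intro convexD_alt) (auto simp: convex_on_def)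
    have "?A \<le> prox_objective \<eta> h v ?w"
      using prox_is_arg_min[of v] w by (simp add: is_arg_min_linorder)
    also have "\<dots> = h ?w + c * (norm (?w - v))\<^sup>2" by (rule obj)
    also have "h ?w \<le> (1 - t) * h ?y + t * h z"
      using convex_onD[OF h_convex] t prox_in z by simp
    also have "(norm (?w - v))\<^sup>2
        = (1 - t) * (norm (?y - v))\<^sup>2 + t * (norm (z - v))\<^sup>2 - t * (1 - t) * (norm (z - ?y))\<^sup>2"
      unfolding power2_norm_eq_inner by (simp add: algebra_simps inner_commute)
    finally have "?A \<le> (1 - t) * ?A + t * ?B - c * (t * (1 - t)) * (norm (z - ?y))\<^sup>2"
      using c by (simp add: obj algebra_simps)
    then have "t * (s * (c * (norm (z - ?y))\<^sup>2)) \<le> t * (?B - ?A)"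
      by (simp add: t_def algebra_simps)
    then show "s * (c * (norm (z - ?y))\<^sup>2) \<le> ?B - ?A"
      using t by (simp add: mult_le_cancel_left_pos)
  qed
  then show ?thesis by (simp add: c_def)
qed

text \<open>Three-point inequality: once the squares around \<open>x - \<eta> *\<^sub>R u\<close>
  are expanded, the terms in \<open>(norm u)\<^sup>2\<close> cancel and \<open>u\<close> remains
  only in an inner product.\<close>

lemma prox_step_h:
  assumes z: "z \<in> \<Omega>" and y: "y = prox \<eta> h \<Omega> (x - \<eta> *\<^sub>R u)"
  shows "h y \<le> h z + u \<bullet> (z - y)
    + ((norm (z - x))\<^sup>2 - (norm (y - x))\<^sup>2 - (norm (z - y))\<^sup>2) / (2 * \<eta>)"
proof -
  have sq: "(norm (w - (x - \<eta> *\<^sub>R u)))\<^sup>2 / (2 * \<eta>)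
      = (norm (w - x))\<^sup>2 / (2 * \<eta>) + u \<bullet> (w - x) + \<eta> / 2 * (norm u)\<^sup>2" for w
  proof -
    have "(norm (w - (x - \<eta> *\<^sub>R u)))\<^sup>2
        = (norm (w - x))\<^sup>2 + 2 * \<eta> * (u \<bullet> (w - x)) + \<eta>\<^sup>2 * (norm u)\<^sup>2"
      unfolding power2_norm_eq_inner by (simp add: algebra_simps inner_commute power2_eq_square)
    then show ?thesis using step_pos by (simp add: field_simps power2_eq_square)
  qed
  show ?thesis
    using prox_objective_gap[OF z, of "x - \<eta> *\<^sub>R u", folded y] sq[of y] sq[of z]
    by (simp add: prox_objective_def inner_diff_right diff_divide_distrib)
qed

end

locale composite = smooth_on F \<Omega> L + proximal h \<Omega> \<eta>
  for F h :: "'a::euclidean_space \<Rightarrow> real" and \<Omega> :: "'a set" and L \<eta> :: real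
begin

text \<open>Sum of the upper quadratic bound from \<open>x\<close> to \<open>y\<close>, the lower
  one from \<open>x\<close> to \<open>z\<close>, and the three-point inequality. The point
  \<open>z\<close> is left free because two choices are needed: \<open>x\<close> itself and the
  endpoint of the exact step.\<close>

lemma prox_descent:
  assumes x: "x \<in> \<Omega>" and z: "z \<in> \<Omega>" and y: "y = prox \<eta> h \<Omega> (x - \<eta> *\<^sub>R u)"
  shows "F y + h y \<le> F z + h z + (grad F x - u) \<bullet> (y - z)
    + (L / 2 - 1 / (2 * \<eta>)) * (norm (y - x))\<^sup>2
    + (L / 2 + 1 / (2 * \<eta>)) * (norm (z - x))\<^sup>2 - (norm (z - y))\<^sup>2 / (2 * \<eta>)"
proof -
  have "y \<in> \<Omega>" using y prox_in by simp
  then show ?thesis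
    using taylor_upper[OF x \<open>y \<in> \<Omega>\<close>] taylor_lower[OF x z] prox_step_h[OF z y]
    by (simp add: inner_diff_left inner_diff_right algebra_simps diff_divide_distrib add_divide_distrib)
qed

text \<open>Descent of the step along \<open>u\<close>, obtained by going through the point reached by the step along
  the exact gradient.\<close>

lemma inexact_descent:
  assumes x: "x \<in> \<Omega>" and y: "y = prox \<eta> h \<Omega> (x - \<eta> *\<^sub>R u)"
  shows "F y + h y \<le> F x + h x
    - \<eta>\<^sup>2 * (1 / (2 * \<eta>) - L) * (norm (gradient_mapping \<eta> h \<Omega> F x))\<^sup>2
    - (1 / (2 * \<eta>) - L / 2) * (norm (y - x))\<^sup>2 + \<eta> / 2 * (norm (u - grad F x))\<^sup>2"
proof -
  define z where "z = prox \<eta> h \<Omega> (x - \<eta> *\<^sub>R grad F x)"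
  have z: "z \<in> \<Omega>" by (simp add: z_def prox_in)
  have G: "(norm (z - x))\<^sup>2 = \<eta>\<^sup>2 * (norm (gradient_mapping \<eta> h \<Omega> F x))\<^sup>2"
    using step_pos by (simp add: gradient_mapping_def z_def[symmetric] norm_minus_commute power_divide)
  \<comment> \<open>The weights of Young's inequality are chosen so that its last term is exactly
    the \<open>(norm (z - y))\<^sup>2 / (2 * \<eta>)\<close> that \<open>prox_descent\<close>
    subtracts.\<close>
  have young: "(grad F x - u) \<bullet> (y - z) \<le> \<eta> / 2 * (norm (u - grad F x))\<^sup>2 + (norm (z - y))\<^sup>2 / (2 * \<eta>)"
  proof -
    have "0 \<le> (norm (\<eta> *\<^sub>R (grad F x - u) - (y - z)))\<^sup>2" by simp
    also have "\<dots> = \<eta>\<^sup>2 * (norm (u - grad F x))\<^sup>2 - 2 * \<eta> * ((grad F x - u) \<bullet> (y - z)) + (norm (z - y))\<^sup>2"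
      unfolding power2_norm_eq_inner by (simp add: algebra_simps inner_commute power2_eq_square)
    finally show ?thesis using step_pos by (simp add: field_simps power2_eq_square)
  qed
  \<comment> \<open>The exact step compared with staying at \<open>x\<close>, so the gradient error
    vanishes. Adding the comparison of \<open>y\<close> with \<open>z\<close> leaves the coefficient
    \<open>L - 1 / (2 * \<eta>)\<close> for \<open>(norm (z - x))\<^sup>2\<close>.\<close>
  have "F z + h z \<le> F x + h x + (L / 2 - 1 / (2 * \<eta>)) * (norm (z - x))\<^sup>2 - (norm (z - x))\<^sup>2 / (2 * \<eta>)"
    using prox_descent[OF x x z_def] by (simp add: norm_minus_commute)
  then show ?thesis
    using prox_descent[OF x z y] young unfolding G[symmetric] mult.assoc[symmetric]
    by (simp add: algebra_simps G)
qed

end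

section \<open>Distances along a trajectory\<close>

lemma norm_diff_power2_le_path:
  fixes x :: "nat \<Rightarrow> 'a::real_normed_vector"
  assumes "i \<le> t"
  shows "(norm (x t - x i))\<^sup>2 \<le> (real t - real i) * (\<Sum>j\<in>{i..<t}. (norm (x (Suc j) - x j))\<^sup>2)"
proof -
  have "norm (x t - x i) \<le> (\<Sum>j\<in>{i..<t}. norm (x (Suc j) - x j))"
    using sum_Suc_diff'[OF assms, of x] norm_sum[of "\<lambda>j. x (Suc j) - x j" "{i..<t}"] by simp
  then have "(norm (x t - x i))\<^sup>2 \<le> (\<Sum>j\<in>{i..<t}. norm (x (Suc j) - x j))\<^sup>2"
    by (intro power_mono) auto
  also have "\<dots> \<le> (\<Sum>j\<in>{i..<t}. (norm (x (Suc j) - x j))\<^sup>2) * (\<Sum>j\<in>{i..<t}. 1\<^sup>2)"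
    using Cauchy_Schwarz_ineq_sum[of "\<lambda>j. norm (x (Suc j) - x j)" "\<lambda>_. 1" "{i..<t}"] by simp
  finally show ?thesis using assms by (simp add: of_nat_diff mult.commute)
qed

text \<open>Double counting. One factor \<open>\<tau>\<close> is the length of the path from
  \<open>x (D t)\<close> to \<open>x t\<close>; the other appears after exchanging the sums, because
  the move at \<open>j\<close> lies on such a path only for \<open>j < t \<le> j + \<tau>\<close>.
  The floor is there because \<open>\<tau>\<close> is real.\<close>

lemma sum_delayed_diff_le:
  fixes x :: "nat \<Rightarrow> 'a::real_normed_vector"
  assumes "\<tau> \<ge> 0" and D: "\<And>t. t < m \<Longrightarrow> D t \<le> t" "\<And>t. t < m \<Longrightarrow> real t - real (D t) \<le> \<tau>"
  shows "(\<Sum>t<m. (norm (x (D t) - x t))\<^sup>2) \<le> \<tau>\<^sup>2 * (\<Sum>t<m. (norm (x (Suc t) - x t))\<^sup>2)"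
proof -
  let ?\<Delta> = "\<lambda>j. (norm (x (Suc j) - x j))\<^sup>2"
  have "(\<Sum>t<m. (norm (x (D t) - x t))\<^sup>2) \<le> (\<Sum>t<m. \<tau> * (\<Sum>j\<in>{D t..<t}. ?\<Delta> j))"
  proof (rule sum_mono)
    fix t assume "t \<in> {..<m}"
    then have t: "t < m" by simp
    have "(norm (x (D t) - x t))\<^sup>2 \<le> (real t - real (D t)) * (\<Sum>j\<in>{D t..<t}. ?\<Delta> j)"
      using norm_diff_power2_le_path[OF D(1)[OF t], of x] by (simp add: norm_minus_commute)
    also have "\<dots> \<le> \<tau> * (\<Sum>j\<in>{D t..<t}. ?\<Delta> j)"
      by (intro mult_right_mono D(2) t sum_nonneg) simp
    finally show "(norm (x (D t) - x t))\<^sup>2 \<le> \<tau> * (\<Sum>j\<in>{D t..<t}. ?\<Delta> j)" .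
  qed
  also have "\<dots> = \<tau> * (\<Sum>t<m. \<Sum>j | j \<in> {..<m} \<and> D t \<le> j \<and> j < t. ?\<Delta> j)"
    unfolding sum_distrib_left[symmetric]
    by (intro arg_cong[where f = "(*) \<tau>"] sum.cong refl) auto
  also have "\<dots> = \<tau> * (\<Sum>j<m. \<Sum>t | t \<in> {..<m} \<and> D t \<le> j \<and> j < t. ?\<Delta> j)"
    by (subst sum.swap_restrict) auto
  also have "\<dots> \<le> \<tau> * (\<Sum>j<m. \<tau> * ?\<Delta> j)"
  proof (intro mult_left_mono sum_mono)
    fix j
    have "{t. t \<in> {..<m} \<and> D t \<le> j \<and> j < t} \<subseteq> {Suc j..j + nat \<lfloor>\<tau>\<rfloor>}"
    proof safe
      fix t assume "t < m" "D t \<le> j" "j < t"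
      then have "real t - real j \<le> \<tau>" using D(2)[of t] by linarith
      then have "int t - int j \<le> \<lfloor>\<tau>\<rfloor>" by (simp add: le_floor_iff)
      with \<open>j < t\<close> show "t \<in> {Suc j..j + nat \<lfloor>\<tau>\<rfloor>}" by auto
    qed
    from card_mono[OF _ this] have "card {t. t \<in> {..<m} \<and> D t \<le> j \<and> j < t} \<le> nat \<lfloor>\<tau>\<rfloor>" by simp
    then have "real (card {t. t \<in> {..<m} \<and> D t \<le> j \<and> j < t}) \<le> \<tau>"
      using \<open>\<tau> \<ge> 0\<close> by linarith
    then show "(\<Sum>t | t \<in> {..<m} \<and> D t \<le> j \<and> j < t. ?\<Delta> j) \<le> \<tau> * ?\<Delta> j"
      by (simp add: mult_right_mono)
  qed (use assms in auto)
  finally show ?thesis by (simp add: sum_distrib_left[symmetric] power2_eq_square)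
qed

text \<open>Each path is enlarged to the whole epoch: one factor \<open>m\<close> bounds the path
  length, the other counts the values of \<open>t\<close>.\<close>

lemma sum_initial_diff_le:
  fixes x :: "nat \<Rightarrow> 'a::real_normed_vector"
  shows "(\<Sum>t<m. (norm (x t - x 0))\<^sup>2) \<le> (real m)\<^sup>2 * (\<Sum>t<m. (norm (x (Suc t) - x t))\<^sup>2)"
proof -
  let ?\<Delta> = "\<lambda>j. (norm (x (Suc j) - x j))\<^sup>2"
  have "(\<Sum>t<m. (norm (x t - x 0))\<^sup>2) \<le> (\<Sum>t<m. real m * (\<Sum>j<m. ?\<Delta> j))"
  proof (rule sum_mono)
    fix t assume "t \<in> {..<m}"
    have "(norm (x t - x 0))\<^sup>2 \<le> real t * (\<Sum>j\<in>{0..<t}. ?\<Delta> j)"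
      using norm_diff_power2_le_path[of 0 t x] by simp
    also have "\<dots> \<le> real m * (\<Sum>j<m. ?\<Delta> j)"
      using \<open>t \<in> {..<m}\<close> by (intro mult_mono sum_mono2 sum_nonneg) auto
    finally show "(norm (x t - x 0))\<^sup>2 \<le> real m * (\<Sum>j<m. ?\<Delta> j)" .
  qed
  then show ?thesis by (simp add: power2_eq_square)
qed

text \<open>The part of the decrease due to the distances between consecutive iterates, minus the error due
  to delay and outdated snapshot. It can be negative in the middle of an epoch, but not at its end.\<close>

definition drift :: "real \<Rightarrow> real \<Rightarrow> (nat \<Rightarrow> nat) \<Rightarrow> 'a::real_normed_vector list \<Rightarrow> real" where
  "drift \<kappa> B D ys = (\<Sum>t<length ys - 1. \<kappa> * (norm (ys ! Suc t - ys ! t))\<^sup>2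
     - B * ((norm (ys ! D t - ys ! t))\<^sup>2 + (norm (ys ! t - ys ! 0))\<^sup>2))"

text \<open>Delays that do not point into the future refer to entries already present, so appending
  an iterate leaves the earlier summands unchanged and adds one.\<close>

lemma drift_snoc:
  assumes "length ys = Suc t" and "D t \<le> t" "\<And>t'. t' < t \<Longrightarrow> D t' \<le> t'"
  shows "drift \<kappa> B D (ys @ [y]) = drift \<kappa> B D ys + \<kappa> * (norm (y - last ys))\<^sup>2
     - B * ((norm (ys ! D t - last ys))\<^sup>2 + (norm (last ys - ys ! 0))\<^sup>2)"
proof -
  have "last ys = ys ! t" using assms(1) by (cases ys rule: rev_cases) (auto simp: nth_append)
  moreover have "(ys @ [y]) ! D t' = ys ! D t'" if "t' < t" for t'
    using assms(1) assms(3)[OF that] that by (simp add: nth_append)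
  ultimately show ?thesis using assms by (simp add: drift_def nth_append)
qed

text \<open>Holds for every list, with no expectation involved: both error sums are bounded by
  multiples of the same sum of squared moves.\<close>

lemma drift_nonneg:
  assumes "length ys = Suc m" and "\<tau> \<ge> 0" and "\<And>t. t < m \<Longrightarrow> D t \<le> t"
    and "\<And>t. t < m \<Longrightarrow> real t - real (D t) \<le> \<tau>"
    and "B \<ge> 0" and "B * (\<tau>\<^sup>2 + (real m)\<^sup>2) \<le> \<kappa>"
  shows "0 \<le> drift \<kappa> B D ys"
proof -
  let ?\<Delta> = "\<Sum>t<m. (norm (ys ! Suc t - ys ! t))\<^sup>2"
  have "B * ((\<Sum>t<m. (norm (ys ! D t - ys ! t))\<^sup>2) + (\<Sum>t<m. (norm (ys ! t - ys ! 0))\<^sup>2))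
      \<le> B * (\<tau>\<^sup>2 * ?\<Delta> + (real m)\<^sup>2 * ?\<Delta>)"
    using assms by (intro mult_left_mono add_mono sum_delayed_diff_le sum_initial_diff_le) auto
  also have "\<dots> = (B * (\<tau>\<^sup>2 + (real m)\<^sup>2)) * ?\<Delta>" by (simp add: algebra_simps)
  also have "\<dots> \<le> \<kappa> * ?\<Delta>" using assms by (intro mult_right_mono sum_nonneg) auto
  finally show ?thesis
    using assms(1) by (simp add: drift_def sum_subtractf sum_distrib_left[symmetric] sum.distrib)
qed

section \<open>The algorithm as a finitely supported process\<close>

lemma finite_set_model_point: "finite (set_pmf (model_point bx y xs))"
  by (simp add: model_point_def finite_set_quantize_max)

lemma expectation_model_point:
  "bx \<ge> 2 \<Longrightarrow> measure_pmf.expectation (model_point bx y xs) (\<lambda>w. w) = y"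
  by (simp add: model_point_def expectation_quantize_max)

lemma finite_set_perform_iteration:
  "finite (set_pmf A) \<Longrightarrow> finite (set_pmf (perform_iteration f bx b sel A j hist ys))"
  by (simp add: perform_iteration_def Let_def finite_set_model_point finite_set_sparsify
      finite_set_quantize_max)

lemma perform_iteration_fields:
  assumes "e \<in> set_pmf (perform_iteration f bx b sel A j hist ys)"
  shows "current e = last ys" "snapshot e = ys ! 0" "stale e = ys ! j"
  using assms by (auto simp: perform_iteration_def Let_def)

text \<open>Transfers hypotheses about records of iterations to the individual random choices: every
  pair of a possible model point and a possible index occurs in some record.\<close>

lemma perform_iteration_covers:
  assumes "w \<in> set_pmf (model_point bx (ys ! j) (ys ! 0))" and "a \<in> set_pmf A"
  obtains e where "e \<in> set_pmf (perform_iteration f bx b sel A j hist ys)"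
    and "model e = w" and "alpha e = grad (f a) w - grad (f a) (ys ! 0)"
    and "probs e = sel hist (grad (f a) w - grad (f a) (ys ! 0))"
proof -
  let ?\<alpha> = "grad (f a) w - grad (f a) (ys ! 0)"
  obtain \<beta> where \<beta>: "\<beta> \<in> set_pmf (sparsify (sel hist ?\<alpha>) ?\<alpha>)" using set_pmf_not_empty by fast
  obtain \<zeta> where "\<zeta> \<in> set_pmf (quantize_max b \<beta>)" using set_pmf_not_empty by fast
  with assms \<beta> have "\<lparr>current = last ys, snapshot = ys ! 0, stale = ys ! j, model = w, index = a,
      alpha = ?\<alpha>, probs = sel hist ?\<alpha>, beta = \<beta>, zeta = \<zeta>\<rparr>
      \<in> set_pmf (perform_iteration f bx b sel A j hist ys)"
    by (auto simp: perform_iteration_def Let_def)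
  from that[OF this] show ?thesis by simp
qed

text \<open>The next iterate depends on the random choices only through \<open>zeta\<close>; its law
  is written as nested draws so that the error can be averaged one layer at a time.\<close>

lemma map_zeta_perform_iteration:
  "map_pmf zeta (perform_iteration f bx b sel A j hist ys) =
    model_point bx (ys ! j) (ys ! 0) \<bind> (\<lambda>w. A \<bind> (\<lambda>a.
      let \<alpha> = grad (f a) w - grad (f a) (ys ! 0) in compress b (sel hist \<alpha>) \<alpha>))"
  by (simp add: perform_iteration_def Let_def compress_def map_bind_pmf bind_return_pmf')

section \<open>Finite support and extension of partial runs\<close>

lemma finite_set_epoch:
  assumes "\<And>t'. t' < t \<Longrightarrow> finite (set_pmf (A t'))"
  shows "finite (set_pmf (epoch n f h \<Omega> \<eta> bx b sel D A hist xs t))"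
  using assms by (induction t) (auto simp: split_beta finite_set_perform_iteration)

lemma finite_set_sparse_asylpg:
  assumes "\<And>s' t. s' < s \<Longrightarrow> t < m \<Longrightarrow> finite (set_pmf (A s' t))"
  shows "finite (set_pmf (sparse_asylpg n f h \<Omega> \<eta> bx b sel D A x0 m s))"
  using assms by (induction s) (auto simp: split_beta intro!: finite_set_epoch)

lemma epoch_SucI:
  assumes "(hist', ys) \<in> set_pmf (epoch n f h \<Omega> \<eta> bx b sel D A hist xs t)"
    and "e \<in> set_pmf (perform_iteration f bx b sel (A t) (D t) hist' ys)"
  shows "(hist' @ [e], ys @ [next_iterate n f h \<Omega> \<eta> e])
    \<in> set_pmf (epoch n f h \<Omega> \<eta> bx b sel D A hist xs (Suc t))"
  using assms by (auto intro!: bexI[of _ "(hist', ys)"])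

lemma sparse_asylpg_SucI:
  assumes "(hist, xs) \<in> set_pmf (sparse_asylpg n f h \<Omega> \<eta> bx b sel D A x0 m s)"
    and "(hist', ys) \<in> set_pmf (epoch n f h \<Omega> \<eta> bx b sel (D s) (A s) hist xs m)"
  shows "(hist', last ys) \<in> set_pmf (sparse_asylpg n f h \<Omega> \<eta> bx b sel D A x0 m (Suc s))"
  using assms by (auto intro!: bexI[of _ "(hist, xs)"] bexI[of _ "(hist', ys)"])

lemma epoch_invariant:
  assumes "(hist', ys) \<in> set_pmf (epoch n f h \<Omega> \<eta> bx b sel D A hist xs t)"
  shows "length ys = Suc t \<and> ys ! 0 = xs \<and> (\<exists>es. hist' = hist @ es \<and> length es = t)"
  using assms
  by (induction t arbitrary: hist' ys) (fastforce simp: nth_append)+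

text \<open>Supports are nonempty, so a partial epoch can always be continued, and histories only
  grow. This is needed because \<open>possible_iterations\<close> is defined from complete
  runs.\<close>

lemma epoch_extend:
  assumes "(hist', ys) \<in> set_pmf (epoch n f h \<Omega> \<eta> bx b sel D A hist xs t)" and "t \<le> t'"
  shows "\<exists>hist'' ys'. (hist'', ys') \<in> set_pmf (epoch n f h \<Omega> \<eta> bx b sel D A hist xs t')
    \<and> set hist' \<subseteq> set hist''"
  using assms(2)
proof (induction t' rule: dec_induct)
  case base
  with assms(1) show ?case by blast
next
  case (step t')
  then obtain hist'' ys' where 1: "(hist'', ys') \<in> set_pmf (epoch n f h \<Omega> \<eta> bx b sel D A hist xs t')"
    and 2: "set hist' \<subseteq> set hist''" by blast
  obtain e where "e \<in> set_pmf (perform_iteration f bx b sel (A t') (D t') hist'' ys')"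
    using set_pmf_not_empty by fast
  from epoch_SucI[OF 1 this] 2 show ?case by fastforce
qed

lemma sparse_asylpg_extend:
  assumes "(hist, xs) \<in> set_pmf (sparse_asylpg n f h \<Omega> \<eta> bx b sel D A x0 m s)" and "s \<le> s'"
  shows "\<exists>hist' xs'. (hist', xs') \<in> set_pmf (sparse_asylpg n f h \<Omega> \<eta> bx b sel D A x0 m s')
    \<and> set hist \<subseteq> set hist'"
  using assms(2)
proof (induction s' rule: dec_induct)
  case base
  with assms(1) show ?case by blast
next
  case (step s')
  then obtain hist' xs' where 1: "(hist', xs') \<in> set_pmf (sparse_asylpg n f h \<Omega> \<eta> bx b sel D A x0 m s')"
    and 2: "set hist \<subseteq> set hist'" by blast
  obtain hist'' ys where
    3: "(hist'', ys) \<in> set_pmf (epoch n f h \<Omega> \<eta> bx b sel (D s') (A s') hist' xs' m)"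
    by (metis ex_in_conv set_pmf_not_empty surj_pair)
  then have "set hist' \<subseteq> set hist''" using epoch_invariant by fastforce
  with 2 sparse_asylpg_SucI[OF 1 3] show ?case by blast
qed

lemma epoch_possible:
  assumes "(hist, xs) \<in> set_pmf (sparse_asylpg n f h \<Omega> \<eta> bx b sel D A x0 m s)"
    and "(hist', ys) \<in> set_pmf (epoch n f h \<Omega> \<eta> bx b sel (D s) (A s) hist xs t)"
    and "s < S" and "t \<le> m"
  shows "set hist' \<subseteq> possible_iterations n f h \<Omega> \<eta> bx b sel D A x0 m S"
proof -
  obtain hist'' ys' where 1: "(hist'', ys') \<in> set_pmf (epoch n f h \<Omega> \<eta> bx b sel (D s) (A s) hist xs m)"
    and 2: "set hist' \<subseteq> set hist''" using epoch_extend[OF assms(2,4)] by blast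
  have "(hist'', last ys') \<in> set_pmf (sparse_asylpg n f h \<Omega> \<eta> bx b sel D A x0 m (Suc s))"
    using assms(1) 1 by (rule sparse_asylpg_SucI)
  from sparse_asylpg_extend[OF this, of S] \<open>s < S\<close> 2 show ?thesis
    unfolding possible_iterations_def by fastforce
qed

lemma perform_iteration_possible:
  assumes "(hist, xs) \<in> set_pmf (sparse_asylpg n f h \<Omega> \<eta> bx b sel D A x0 m s)"
    and "(hist', ys) \<in> set_pmf (epoch n f h \<Omega> \<eta> bx b sel (D s) (A s) hist xs t)"
    and "s < S" and "t < m"
  shows "set_pmf (perform_iteration f bx b sel (A s t) (D s t) hist' ys)
    \<subseteq> possible_iterations n f h \<Omega> \<eta> bx b sel D A x0 m S"
proof
  fix e assume "e \<in> set_pmf (perform_iteration f bx b sel (A s t) (D s t) hist' ys)"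
  from epoch_possible[OF assms(1) epoch_SucI[OF assms(2) this] assms(3)] \<open>t < m\<close>
  show "e \<in> possible_iterations n f h \<Omega> \<eta> bx b sel D A x0 m S" by simp
qed

lemma length_sparse_asylpg:
  assumes "(hist, xs) \<in> set_pmf (sparse_asylpg n f h \<Omega> \<eta> bx b sel D A x0 m s)"
  shows "length hist = s * m"
  using assms
proof (induction s arbitrary: hist xs)
  case (Suc s)
  then obtain hist0 xs0 ys where
    "(hist0, xs0) \<in> set_pmf (sparse_asylpg n f h \<Omega> \<eta> bx b sel D A x0 m s)"
    "(hist, ys) \<in> set_pmf (epoch n f h \<Omega> \<eta> bx b sel (D s) (A s) hist0 xs0 m)" by auto
  with Suc.IH epoch_invariant show ?case by fastforce
qed simp

text \<open>Matches the flat history with the pair of epoch and inner index from which the output is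
  drawn.\<close>

lemma sum_list_eq_sum_blocks:
  fixes g :: "'a \<Rightarrow> real"
  assumes "length xs = k * l"
  shows "(\<Sum>x\<leftarrow>xs. g x) = (\<Sum>(i, j)\<in>{..<k} \<times> {..<l}. g (xs ! (i * l + j)))"
proof -
  have "(\<Sum>x\<leftarrow>xs. g x) = (\<Sum>i<k * l. g (xs ! i))"
    using assms by (simp add: sum_list_sum_nth atLeast0LessThan)
  also have "\<dots> = (\<Sum>i<k. \<Sum>j\<in>{i * l..<i * l + l}. g (xs ! j))"
    by (rule sum.nat_group[symmetric])
  also have "\<dots> = (\<Sum>i<k. \<Sum>j<l. g (xs ! (i * l + j)))"
  proof (rule sum.cong[OF refl])
    fix i
    show "(\<Sum>j\<in>{i * l..<i * l + l}. g (xs ! j)) = (\<Sum>j<l. g (xs ! (i * l + j)))"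
      using sum.shift_bounds_nat_ivl[of "\<lambda>j. g (xs ! j)" 0 "i * l" l]
      by (simp add: atLeast0LessThan add.commute)
  qed
  finally show ?thesis by (simp add: sum.cartesian_product)
qed

section \<open>Convergence\<close>

locale sparse_asylpg_run =
  fixes f :: "nat \<Rightarrow> real ^ 'd::finite \<Rightarrow> real"
    and h P :: "real ^ 'd \<Rightarrow> real"
    and \<Omega> :: "(real ^ 'd) set"
    and x0 xstar :: "real ^ 'd"
    and n m S b bx :: nat
    and L \<rho> \<eta> \<mu> \<tau> \<phi> \<Gamma> :: real
    and D :: "nat \<Rightarrow> nat \<Rightarrow> nat"
    and A :: "nat \<Rightarrow> nat \<Rightarrow> nat pmf"
    and sel :: "'d selection"
    and iters :: "'d iteration set"
  assumes n: "n \<ge> 1" and m: "m \<ge> 1" and S: "S \<ge> 1" and b: "b \<ge> 2" and bx: "bx \<ge> 2"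
    and mu: "\<mu> > 0" and tau: "\<tau> > 0" and L: "L > 0" and rho: "0 < \<rho>" "\<rho> < 1 / 2"
    and eta: "\<eta> = \<rho> / L"
    and Omega_convex: "convex \<Omega>"
    and h_convex: "convex_on \<Omega> h"
    and prox_exists: "\<And>x. \<exists>y. is_arg_min (prox_objective \<eta> h x) (\<lambda>y. y \<in> \<Omega>) y"
    and P_def: "P = (\<lambda>x. average n f x + h x)"
    and optimal: "is_arg_min P (\<lambda>x. x \<in> \<Omega>) xstar"
    and x0: "x0 \<in> \<Omega>"
    and differentiable: "\<And>i x. i \<in> {1..n} \<Longrightarrow> x \<in> \<Omega> \<Longrightarrow> f i differentiable (at x)"
    and smooth: "\<And>i x y. i \<in> {1..n} \<Longrightarrow> x \<in> \<Omega> \<Longrightarrow> y \<in> \<Omega> \<Longrightarrow>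
                   norm (grad (f i) x - grad (f i) y) \<le> L * norm (x - y)"
    and index_range: "\<And>s t. s < S \<Longrightarrow> t < m \<Longrightarrow> set_pmf (A s t) \<subseteq> {1..n}"
    and index_unbiased: "\<And>s t x. s < S \<Longrightarrow> t < m \<Longrightarrow> x \<in> \<Omega> \<Longrightarrow>
          measure_pmf.expectation (A s t) (\<lambda>a. grad (f a) x) = grad (average n f) x"
    and delay_index: "\<And>s t. s < S \<Longrightarrow> t < m \<Longrightarrow> D s t \<le> t"
    and delay_bound: "\<And>s t. s < S \<Longrightarrow> t < m \<Longrightarrow> real t - real (D s t) \<le> \<tau>"
    and iters: "iters = possible_iterations n f h \<Omega> \<eta> bx b sel D A x0 m S"
    and model_in_Omega: "\<And>e. e \<in> iters \<Longrightarrow> model e \<in> \<Omega>"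
    and model_precision: "\<And>e. e \<in> iters \<Longrightarrow>
          measure_pmf.expectation (model_point bx (stale e) (snapshot e))
              (\<lambda>w. (norm (w - stale e))\<^sup>2)
            \<le> \<mu> * (norm (stale e - snapshot e))\<^sup>2"
    and probabilities: "\<And>e i. e \<in> iters \<Longrightarrow> 0 \<le> probs e $ i \<and> probs e $ i \<le> 1"
    and budget_pos: "\<And>e. e \<in> iters \<Longrightarrow> budget e > 0"
    and budget_bound: "\<And>e. e \<in> iters \<Longrightarrow> alpha e \<noteq> 0 \<Longrightarrow>
          budget e \<le> norm1 (alpha e) / infnorm (alpha e)"
    and probs_eq: "\<And>e i. e \<in> iters \<Longrightarrow> alpha e \<noteq> 0 \<Longrightarrow>
          probs e $ i = \<bar>alpha e $ i\<bar> * budget e / norm1 (alpha e)"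
    and phi: "\<phi> = Min (budget ` iters)"
    and Gamma: "\<Gamma> = (real CARD('d))\<^sup>2 / (4 * \<phi> * (2 ^ (b - 1) - 1)\<^sup>2) + real CARD('d) / \<phi> + 1"
    and step_condition:
      "8 * \<rho>\<^sup>2 * (real m)\<^sup>2 * (\<mu> + 1) * \<Gamma> + 2 * \<rho>\<^sup>2 * (\<mu> + 1) * \<tau>\<^sup>2 * \<Gamma> + \<rho> \<le> 1"
begin

abbreviation F :: "real ^ 'd \<Rightarrow> real" where
  "F \<equiv> average n f"

abbreviation G :: "real ^ 'd \<Rightarrow> real ^ 'd" where
  "G \<equiv> gradient_mapping \<eta> h \<Omega> F"

sublocale composite F h \<Omega> L \<eta>
proof
  show "0 < \<eta>" using rho L by (simp add: eta)
  show "GDERIV F x :> grad F x" if "x \<in> \<Omega>" for x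
    using GDERIV_average[of n f x] differentiable that by (metis grad_average)
  show "norm (grad F x - grad F y) \<le> L * norm (x - y)" if "x \<in> \<Omega>" "y \<in> \<Omega>" for x y
    using n differentiable smooth that by (intro grad_average_Lipschitz) auto
qed (use Omega_convex h_convex prox_exists in auto)

lemma finite_set_index: "s < S \<Longrightarrow> t < m \<Longrightarrow> finite (set_pmf (A s t))"
  by (rule finite_subset[OF index_range]) auto

text \<open>With nonemptiness, this makes \<open>\<phi>\<close>, defined by \<open>Min\<close>, an
  attained minimum: it bounds all budgets from below and inherits their positivity.\<close>

lemma finite_iters: "finite iters"
  unfolding iters possible_iterations_def
  by (intro finite_UN_I finite_set_sparse_asylpg finite_set_index) auto

lemma iters_not_empty: "iters \<noteq> {}"
proof -
  obtain hist xs where 1: "(hist, xs) \<in> set_pmf (sparse_asylpg n f h \<Omega> \<eta> bx b sel D A x0 m S)"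
    by (metis ex_in_conv set_pmf_not_empty surj_pair)
  then have "length hist > 0" using length_sparse_asylpg m S by fastforce
  with 1 show ?thesis unfolding iters possible_iterations_def by fastforce
qed

lemma phi_le: "e \<in> iters \<Longrightarrow> \<phi> \<le> budget e"
  unfolding phi using finite_iters by simp

lemma phi_pos: "\<phi> > 0"
  unfolding phi using finite_iters iters_not_empty budget_pos by (simp add: Min_gr_iff)

lemma Gamma_ge_1: "\<Gamma> \<ge> 1"
  unfolding Gamma using phi_pos by simp

text \<open>The centre \<open>c\<close> is kept general and the cross term linear in
  \<open>\<alpha>\<close>: the sampled index is not averaged yet, and only a linear term lets its
  unbiasedness be used later.\<close>

lemma compress_step:
  assumes e: "e \<in> iters" and \<alpha>: "alpha e = \<alpha>" and p: "probs e = p"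
  shows "measure_pmf.expectation (compress b p \<alpha>) (\<lambda>\<zeta>. (norm (\<zeta> - c))\<^sup>2)
    \<le> (\<Gamma> - 1) * (norm \<alpha>)\<^sup>2 - 2 * (\<alpha> \<bullet> c) + (norm c)\<^sup>2"
proof -
  have *: "0 \<le> p $ i" "p $ i \<le> 1" for i using probabilities[OF e, of i] by (simp_all add: p)
  have sum: "budget e = (\<Sum>i\<in>UNIV. p $ i)" by (simp add: budget_def p)
  have le: "\<phi> \<le> (\<Sum>i\<in>UNIV. p $ i)" using phi_le[OF e] by (simp add: sum)
  have eq: "p $ i = \<bar>\<alpha> $ i\<bar> * (\<Sum>i\<in>UNIV. p $ i) / norm1 \<alpha>" if "\<alpha> \<noteq> 0" for i
    using probs_eq[OF e, unfolded \<alpha> p sum, OF that] .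
  show ?thesis
    using expectation_compress[OF b * phi_pos le eq] expectation_norm_compress[OF b * phi_pos le eq]
    by (simp add: expectation_norm_diff finite_set_compress Gamma)
qed

text \<open>Model quantization is unbiased, so around any centre it only adds its variance, bounded
  by the precision requirement.\<close>

lemma model_point_moment:
  assumes e: "e \<in> iters" and y: "stale e = y" and xs: "snapshot e = xs"
  shows "measure_pmf.expectation (model_point bx y xs) (\<lambda>w. (norm (w - c))\<^sup>2)
    \<le> \<mu> * (norm (y - xs))\<^sup>2 + (norm (y - c))\<^sup>2"
  using expectation_norm_diff_mean[OF finite_set_model_point expectation_model_point[OF bx], of y xs c]
    model_precision[OF e] by (simp add: y xs)

text \<open>The direction misses the gradient at the current iterate by \<open>\<zeta> - c\<close>.
  Averaging proceeds from the inside outwards: compression, then the index, then the model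
  point.\<close>

lemma direction_error:
  assumes st: "s < S" "t < m"
    and iters: "set_pmf (perform_iteration f bx b sel (A s t) j hist ys) \<subseteq> iters"
    and x: "last ys \<in> \<Omega>" and xs: "ys ! 0 \<in> \<Omega>"
  shows "measure_pmf.expectation (perform_iteration f bx b sel (A s t) j hist ys)
      (\<lambda>e. (norm (zeta e + grad F (ys ! 0) - grad F (last ys)))\<^sup>2)
    \<le> 2 * L\<^sup>2 * (\<mu> + 1) * \<Gamma> * ((norm (ys ! j - last ys))\<^sup>2 + (norm (last ys - ys ! 0))\<^sup>2)"
proof -
  let ?x = "last ys" and ?xs = "ys ! 0" and ?y = "ys ! j"
  define c where "c = grad F ?x - grad F ?xs"
  let ?W = "model_point bx ?y ?xs"
  let ?C = "\<lambda>w a. let \<alpha> = grad (f a) w - grad (f a) ?xs in compress b (sel hist \<alpha>) \<alpha>"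
  \<comment> \<open>Any possible iteration serves as a witness: all share the same stale iterate and
    snapshot, and the precision requirement is stated only for members of
    \<open>iters\<close>.\<close>
  obtain w0 where "w0 \<in> set_pmf ?W" by (metis ex_in_conv set_pmf_not_empty)
  moreover obtain a0 where a0: "a0 \<in> set_pmf (A s t)" by (metis ex_in_conv set_pmf_not_empty)
  ultimately obtain e0 where e0: "e0 \<in> set_pmf (perform_iteration f bx b sel (A s t) j hist ys)"
    by (rule perform_iteration_covers)
  note e0_fields = perform_iteration_fields(2,3)[OF e0]
  have e0': "e0 \<in> iters" using e0 iters by blast
  have finC: "finite (set_pmf (?C w a))" for w a by (simp add: Let_def finite_set_compress)
  have finA: "finite (set_pmf (A s t))" using st by (rule finite_set_index)
  have inner: "measure_pmf.expectation (A s t \<bind> ?C w) (\<lambda>\<zeta>. (norm (\<zeta> - c))\<^sup>2)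
      \<le> L\<^sup>2 * ((\<Gamma> - 1) * (norm (w - ?xs))\<^sup>2 + (norm (w - ?x))\<^sup>2)" if w: "w \<in> set_pmf ?W" for w
  proof -
    obtain e1 where "e1 \<in> set_pmf (perform_iteration f bx b sel (A s t) j hist ys)" "model e1 = w"
      using perform_iteration_covers[OF w a0] .
    then have w\<Omega>: "w \<in> \<Omega>" using model_in_Omega iters by blast
    let ?\<alpha> = "\<lambda>a. grad (f a) w - grad (f a) ?xs"
    have "measure_pmf.expectation (A s t \<bind> ?C w) (\<lambda>\<zeta>. (norm (\<zeta> - c))\<^sup>2)
        = measure_pmf.expectation (A s t)
            (\<lambda>a. measure_pmf.expectation (?C w a) (\<lambda>\<zeta>. (norm (\<zeta> - c))\<^sup>2))"
      by (rule expectation_bind_finite[OF finA finC])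
    also have "\<dots> \<le> measure_pmf.expectation (A s t)
        (\<lambda>a. (\<Gamma> - 1) * (L\<^sup>2 * (norm (w - ?xs))\<^sup>2) - 2 * (?\<alpha> a \<bullet> c) + (norm c)\<^sup>2)"
    proof (rule expectation_mono_finite[OF finA])
      fix a assume a: "a \<in> set_pmf (A s t)"
      obtain e where e: "e \<in> set_pmf (perform_iteration f bx b sel (A s t) j hist ys)"
        and ea: "alpha e = ?\<alpha> a" and ep: "probs e = sel hist (?\<alpha> a)"
        using perform_iteration_covers[OF w a] .
      have "e \<in> iters" using e iters by blast
      have "norm (?\<alpha> a) \<le> L * norm (w - ?xs)"
        using index_range[OF st] a w\<Omega> xs by (intro smooth) auto
      then have "(norm (?\<alpha> a))\<^sup>2 \<le> L\<^sup>2 * (norm (w - ?xs))\<^sup>2"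
        by (metis norm_ge_zero power_mono power_mult_distrib)
      then have "(\<Gamma> - 1) * (norm (?\<alpha> a))\<^sup>2 \<le> (\<Gamma> - 1) * (L\<^sup>2 * (norm (w - ?xs))\<^sup>2)"
        using Gamma_ge_1 by (intro mult_left_mono) auto
      then show "measure_pmf.expectation (?C w a) (\<lambda>\<zeta>. (norm (\<zeta> - c))\<^sup>2)
          \<le> (\<Gamma> - 1) * (L\<^sup>2 * (norm (w - ?xs))\<^sup>2) - 2 * (?\<alpha> a \<bullet> c) + (norm c)\<^sup>2"
        using compress_step[OF \<open>e \<in> iters\<close> ea ep, of c] by (simp add: Let_def)
    qed
    also have "\<dots> = (\<Gamma> - 1) * (L\<^sup>2 * (norm (w - ?xs))\<^sup>2)
        - 2 * ((grad F w - grad F ?xs) \<bullet> c) + (norm c)\<^sup>2"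
      by (simp add: finA index_unbiased[OF st w\<Omega>] index_unbiased[OF st xs] inner_diff_left)
    \<comment> \<open>Completing the square with \<open>c\<close> turns the centre into the gradient
      at \<open>?x\<close>; the discarded square of \<open>grad F w - grad F ?xs\<close> has a
      favourable sign.\<close>
    also have "\<dots> \<le> (\<Gamma> - 1) * (L\<^sup>2 * (norm (w - ?xs))\<^sup>2) + (norm (grad F w - grad F ?x))\<^sup>2"
    proof -
      have "(norm (grad F w - grad F ?x))\<^sup>2 = (norm ((grad F w - grad F ?xs) - c))\<^sup>2"
        by (simp add: c_def)
      also have "\<dots> = (norm (grad F w - grad F ?xs))\<^sup>2
          - 2 * ((grad F w - grad F ?xs) \<bullet> c) + (norm c)\<^sup>2"
        unfolding power2_norm_eq_inner by (simp add: inner_diff_left inner_diff_right inner_commute)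
      finally show ?thesis by simp
    qed
    also have "(norm (grad F w - grad F ?x))\<^sup>2 \<le> (L * norm (w - ?x))\<^sup>2"
      using grad_Lipschitz[OF w\<Omega> x] by (intro power_mono) auto
    finally show ?thesis by (simp add: algebra_simps)
  qed
  have "measure_pmf.expectation (perform_iteration f bx b sel (A s t) j hist ys)
      (\<lambda>e. (norm (zeta e + grad F ?xs - grad F ?x))\<^sup>2)
    = measure_pmf.expectation (map_pmf zeta (perform_iteration f bx b sel (A s t) j hist ys))
      (\<lambda>\<zeta>. (norm (\<zeta> - c))\<^sup>2)"
    by (simp add: c_def algebra_simps)
  also have "\<dots> = measure_pmf.expectation ?W
      (\<lambda>w. measure_pmf.expectation (A s t \<bind> ?C w) (\<lambda>\<zeta>. (norm (\<zeta> - c))\<^sup>2))"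
    unfolding map_zeta_perform_iteration
    using finA finC by (intro expectation_bind_finite finite_set_model_point) auto
  also have "\<dots> \<le> measure_pmf.expectation ?W
      (\<lambda>w. L\<^sup>2 * ((\<Gamma> - 1) * (norm (w - ?xs))\<^sup>2 + (norm (w - ?x))\<^sup>2))"
    by (rule expectation_mono_finite[OF finite_set_model_point inner])
  also have "\<dots> = L\<^sup>2 * ((\<Gamma> - 1) * measure_pmf.expectation ?W (\<lambda>w. (norm (w - ?xs))\<^sup>2)
      + measure_pmf.expectation ?W (\<lambda>w. (norm (w - ?x))\<^sup>2))"
    by (simp add: finite_set_model_point)
  also have "\<dots> \<le> L\<^sup>2 * ((\<Gamma> - 1) * (\<mu> * (norm (?y - ?xs))\<^sup>2 + (norm (?y - ?xs))\<^sup>2)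
      + (\<mu> * (norm (?y - ?xs))\<^sup>2 + (norm (?y - ?x))\<^sup>2))"
    using Gamma_ge_1 e0' e0_fields
    by (intro mult_left_mono add_mono model_point_moment) auto
  also have "\<dots> = L\<^sup>2 * (((\<mu> + 1) * \<Gamma> - 1) * (norm (?y - ?xs))\<^sup>2 + (norm (?y - ?x))\<^sup>2)"
    by (simp add: algebra_simps)
  \<comment> \<open>Parallelogram law at the intermediate point \<open>?x\<close>. The
    \<open>- 1\<close> gained before pays for the separate \<open>(norm (?y - ?x))\<^sup>2\<close>:
    its total coefficient is \<open>2 * ((\<mu> + 1) * \<Gamma> - 1) + 1\<close>.\<close>
  also have "\<dots> \<le> L\<^sup>2 * (((\<mu> + 1) * \<Gamma> - 1) * (2 * (norm (?y - ?x))\<^sup>2 + 2 * (norm (?x - ?xs))\<^sup>2)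
      + (norm (?y - ?x))\<^sup>2)"
  proof (intro mult_left_mono add_mono order_refl)
    have "(norm (u + v))\<^sup>2 + (norm (u - v))\<^sup>2 = 2 * (norm u)\<^sup>2 + 2 * (norm v)\<^sup>2" for u v :: "real ^ 'd"
      unfolding power2_norm_eq_inner by (simp add: algebra_simps inner_commute)
    from this[of "?y - ?x" "?x - ?xs"] show "(norm (?y - ?xs))\<^sup>2 \<le> 2 * (norm (?y - ?x))\<^sup>2 + 2 * (norm (?x - ?xs))\<^sup>2"
      by (simp add: sum_squares_ge_zero) (smt (verit) zero_le_power2)
    show "0 \<le> (\<mu> + 1) * \<Gamma> - 1" using mult_mono[of 1 "\<mu> + 1" 1 \<Gamma>] mu Gamma_ge_1 by simp
  qed auto
  also have "\<dots> \<le> 2 * L\<^sup>2 * (\<mu> + 1) * \<Gamma> * ((norm (?y - ?x))\<^sup>2 + (norm (?x - ?xs))\<^sup>2)"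
    by (simp add: algebra_simps)
  finally show ?thesis .
qed


text \<open>A supermartingale along one epoch. The sum over \<open>hist\<close> covers all epochs so
  far, while the drift term sees only the iterates of the current one.\<close>

definition potential :: "(nat \<Rightarrow> nat) \<Rightarrow> 'd iteration list \<times> (real ^ 'd) list \<Rightarrow> real" where
  "potential D' = (\<lambda>(hist, ys). P (last ys)
     + \<rho> * (1 - 2 * \<rho>) / (2 * L) * (\<Sum>e\<leftarrow>hist. (norm (G (current e)))\<^sup>2)
     + drift (1 / (2 * \<eta>) - L / 2) (\<eta> * L\<^sup>2 * (\<mu> + 1) * \<Gamma>) D' ys)"

lemma epoch_in_Omega:
  assumes "(hist', ys) \<in> set_pmf (epoch n f h \<Omega> \<eta> bx b sel D' A' hist xs t)" and "xs \<in> \<Omega>"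
  shows "set ys \<subseteq> \<Omega>"
  using assms
  by (induction t arbitrary: hist' ys) (fastforce simp: next_iterate_def prox_in)+

lemma snapshot_in_Omega:
  assumes "(hist, xs) \<in> set_pmf (sparse_asylpg n f h \<Omega> \<eta> bx b sel D A x0 m s)"
  shows "xs \<in> \<Omega>"
  using assms
proof (induction s arbitrary: hist xs)
  case (Suc s)
  then obtain hist0 xs0 ys where
    1: "(hist0, xs0) \<in> set_pmf (sparse_asylpg n f h \<Omega> \<eta> bx b sel D A x0 m s)"
    and 2: "(hist, ys) \<in> set_pmf (epoch n f h \<Omega> \<eta> bx b sel (D s) (A s) hist0 xs0 m)"
    and 3: "xs = last ys" by auto
  have "ys \<noteq> []" using epoch_invariant[OF 2] by auto
  with epoch_in_Omega[OF 2 Suc.IH[OF 1]] 3 show ?case by auto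
qed (simp add: x0)

lemma potential_step:
  assumes st: "s < S" "t < m"
    and sp: "(hist, xs) \<in> set_pmf (sparse_asylpg n f h \<Omega> \<eta> bx b sel D A x0 m s)"
    and ep: "(hist', ys) \<in> set_pmf (epoch n f h \<Omega> \<eta> bx b sel (D s) (A s) hist xs t)"
  shows "measure_pmf.expectation (perform_iteration f bx b sel (A s t) (D s t) hist' ys)
      (\<lambda>e. potential (D s) (hist' @ [e], ys @ [next_iterate n f h \<Omega> \<eta> e]))
    \<le> potential (D s) (hist', ys)"
proof -
  let ?p = "perform_iteration f bx b sel (A s t) (D s t) hist' ys"
  let ?x = "last ys" and ?xs = "ys ! 0"
  define c where "c = \<rho> * (1 - 2 * \<rho>) / (2 * L)"
  define \<kappa> where "\<kappa> = 1 / (2 * \<eta>) - L / 2"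
  \<comment> \<open>This is \<open>\<eta> / 2\<close> times the constant of
    \<open>direction_error\<close>, so that the expected error and \<open>B * R\<close> cancel
    exactly.\<close>
  define B where "B = \<eta> * L\<^sup>2 * (\<mu> + 1) * \<Gamma>"
  define R where "R = (norm (ys ! D s t - ?x))\<^sup>2 + (norm (?x - ?xs))\<^sup>2"
  \<comment> \<open>The coefficient from \<open>inexact_descent\<close> in terms of
    \<open>\<rho>\<close>; it is the source of the denominator
    \<open>\<rho> * (1 - 2 * \<rho>)\<close> in the final bound.\<close>
  have c: "c = \<eta>\<^sup>2 * (1 / (2 * \<eta>) - L)"
    unfolding c_def eta using rho L by (simp add: field_simps power2_eq_square)
  have len: "length ys = Suc t" using epoch_invariant[OF ep] by simp
  then have "ys \<noteq> []" by auto
  have "set ys \<subseteq> \<Omega>" using epoch_in_Omega[OF ep snapshot_in_Omega[OF sp]] .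
  then have x: "?x \<in> \<Omega>" and xs: "?xs \<in> \<Omega>" using \<open>ys \<noteq> []\<close> len by auto
  have fin: "finite (set_pmf ?p)" by (intro finite_set_perform_iteration finite_set_index st)
  have poss: "set_pmf ?p \<subseteq> iters"
    unfolding iters using perform_iteration_possible[OF sp ep st] .
  have "potential (D s) (hist' @ [e], ys @ [next_iterate n f h \<Omega> \<eta> e])
      \<le> potential (D s) (hist', ys) - B * R
        + \<eta> / 2 * (norm (zeta e + grad F ?xs - grad F ?x))\<^sup>2" if e: "e \<in> set_pmf ?p" for e
  proof -
    note fields = perform_iteration_fields[OF e]
    define y where "y = next_iterate n f h \<Omega> \<eta> e"
    have "y = prox \<eta> h \<Omega> (?x - \<eta> *\<^sub>R (zeta e + grad F ?xs))"
      by (simp add: y_def next_iterate_def fields)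
    from inexact_descent[OF x this]
    have "P y \<le> P ?x - c * (norm (G ?x))\<^sup>2 - \<kappa> * (norm (y - ?x))\<^sup>2
        + \<eta> / 2 * (norm (zeta e + grad F ?xs - grad F ?x))\<^sup>2"
      by (simp add: P_def c \<kappa>_def)
    moreover have "drift \<kappa> B (D s) (ys @ [y])
        = drift \<kappa> B (D s) ys + \<kappa> * (norm (y - ?x))\<^sup>2 - B * R"
      unfolding R_def using len st delay_index by (intro drift_snoc) auto
    ultimately show ?thesis
      unfolding potential_def y_def[symmetric] c_def[symmetric] \<kappa>_def[symmetric] B_def[symmetric]
      by (simp add: fields distrib_left)
  qed
  then have "measure_pmf.expectation ?p
      (\<lambda>e. potential (D s) (hist' @ [e], ys @ [next_iterate n f h \<Omega> \<eta> e]))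
    \<le> measure_pmf.expectation ?p (\<lambda>e. potential (D s) (hist', ys) - B * R
        + \<eta> / 2 * (norm (zeta e + grad F ?xs - grad F ?x))\<^sup>2)"
    by (rule expectation_mono_finite[OF fin])
  also have "\<dots> = potential (D s) (hist', ys) - B * R
      + \<eta> / 2 * measure_pmf.expectation ?p (\<lambda>e. (norm (zeta e + grad F ?xs - grad F ?x))\<^sup>2)"
    by (simp add: fin)
  also have "\<dots> \<le> potential (D s) (hist', ys) - B * R
      + \<eta> / 2 * (2 * L\<^sup>2 * (\<mu> + 1) * \<Gamma> * R)"
    unfolding R_def using step_pos
    by (intro add_left_mono mult_left_mono direction_error st poss x xs) simp
  also have "\<dots> = potential (D s) (hist', ys)" by (simp add: B_def)
  finally show ?thesis .
qed

lemma expectation_potential_epoch: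
  assumes s: "s < S" and t: "t \<le> m"
    and sp: "(hist, xs) \<in> set_pmf (sparse_asylpg n f h \<Omega> \<eta> bx b sel D A x0 m s)"
  shows "measure_pmf.expectation (epoch n f h \<Omega> \<eta> bx b sel (D s) (A s) hist xs t) (potential (D s))
    \<le> potential (D s) (hist, [xs])"
  using t
proof (induction t)
  case (Suc t)
  let ?E = "epoch n f h \<Omega> \<eta> bx b sel (D s) (A s) hist xs t"
  let ?p = "\<lambda>q. perform_iteration f bx b sel (A s t) (D s t) (fst q) (snd q)"
  have t: "t < m" using Suc.prems by simp
  have finE: "finite (set_pmf ?E)" using s t by (intro finite_set_epoch finite_set_index) auto
  have finp: "finite (set_pmf (?p q))" for q by (intro finite_set_perform_iteration finite_set_index s t)
  have "measure_pmf.expectation (epoch n f h \<Omega> \<eta> bx b sel (D s) (A s) hist xs (Suc t)) (potential (D s))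
      = measure_pmf.expectation ?E (\<lambda>q. measure_pmf.expectation (?p q)
          (\<lambda>e. potential (D s) (fst q @ [e], snd q @ [next_iterate n f h \<Omega> \<eta> e])))"
    by (simp add: split_beta expectation_bind_finite finE finp)
  also have "\<dots> \<le> measure_pmf.expectation ?E (potential (D s))"
    by (rule expectation_mono_finite[OF finE]) (use potential_step[OF s t sp] in \<open>auto\<close>)
  also have "\<dots> \<le> potential (D s) (hist, [xs])" using Suc by simp
  finally show ?case .
qed simp

lemma potential_final:
  assumes "s < S" and "length ys = Suc m"
  shows "P (last ys) + \<rho> * (1 - 2 * \<rho>) / (2 * L) * (\<Sum>e\<leftarrow>hist. (norm (G (current e)))\<^sup>2)
    \<le> potential (D s) (hist, ys)"
proof -
  let ?B = "\<eta> * L\<^sup>2 * (\<mu> + 1) * \<Gamma>"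
  have B: "0 \<le> ?B" using step_pos mu Gamma_ge_1 by simp
  have "8 * \<rho>\<^sup>2 * (real m)\<^sup>2 * (\<mu> + 1) * \<Gamma> + 2 * \<rho>\<^sup>2 * (\<mu> + 1) * \<tau>\<^sup>2 * \<Gamma>
      = 2 * \<rho>\<^sup>2 * (\<mu> + 1) * \<Gamma> * (\<tau>\<^sup>2 + (real m)\<^sup>2) + 6 * \<rho>\<^sup>2 * (real m)\<^sup>2 * (\<mu> + 1) * \<Gamma>"
    by (simp add: algebra_simps)
  moreover have "0 \<le> 6 * \<rho>\<^sup>2 * (real m)\<^sup>2 * (\<mu> + 1) * \<Gamma>" using mu Gamma_ge_1 by simp
  ultimately have *: "2 * \<rho>\<^sup>2 * (\<mu> + 1) * \<Gamma> * (\<tau>\<^sup>2 + (real m)\<^sup>2) \<le> 1 - \<rho>"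
    using step_condition by linarith
  have "?B * (\<tau>\<^sup>2 + (real m)\<^sup>2) = L / (2 * \<rho>) * (2 * \<rho>\<^sup>2 * (\<mu> + 1) * \<Gamma> * (\<tau>\<^sup>2 + (real m)\<^sup>2))"
    unfolding eta using L rho by (simp add: field_simps power2_eq_square)
  also have "\<dots> \<le> L / (2 * \<rho>) * (1 - \<rho>)"
    using L rho by (intro mult_left_mono *) simp
  also have "\<dots> = 1 / (2 * \<eta>) - L / 2"
    unfolding eta using L rho by (simp add: field_simps)
  finally have "0 \<le> drift (1 / (2 * \<eta>) - L / 2) ?B (D s) ys"
    using assms B tau delay_index delay_bound
    by (intro drift_nonneg[where \<tau> = \<tau> and m = m]) auto
  then show ?thesis by (simp add: potential_def)
qed

text \<open>Epochs chain together because the drift is an empty sum at the start of each and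
  nonnegative at its end, so only \<open>P\<close> and the sum over the history are passed
  on.\<close>

lemma expectation_sparse_asylpg:
  assumes "s \<le> S"
  shows "measure_pmf.expectation (sparse_asylpg n f h \<Omega> \<eta> bx b sel D A x0 m s)
      (\<lambda>(hist, xs). P xs + \<rho> * (1 - 2 * \<rho>) / (2 * L) * (\<Sum>e\<leftarrow>hist. (norm (G (current e)))\<^sup>2))
    \<le> P x0"
  using assms
proof (induction s)
  case (Suc s)
  let ?V = "\<lambda>(hist, xs). P xs
    + \<rho> * (1 - 2 * \<rho>) / (2 * L) * (\<Sum>e\<leftarrow>hist. (norm (G (current e)))\<^sup>2)"
  let ?R = "sparse_asylpg n f h \<Omega> \<eta> bx b sel D A x0 m s"
  let ?E = "\<lambda>q. epoch n f h \<Omega> \<eta> bx b sel (D s) (A s) (fst q) (snd q) m"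
  have s: "s < S" using Suc.prems by simp
  have finR: "finite (set_pmf ?R)" using s by (intro finite_set_sparse_asylpg finite_set_index) auto
  have finE: "finite (set_pmf (?E q))" for q using s by (intro finite_set_epoch finite_set_index) auto
  have "measure_pmf.expectation (sparse_asylpg n f h \<Omega> \<eta> bx b sel D A x0 m (Suc s)) ?V
      = measure_pmf.expectation ?R (\<lambda>q. measure_pmf.expectation (?E q) (\<lambda>r. ?V (fst r, last (snd r))))"
    by (simp add: split_beta expectation_bind_finite finR finE)
  also have "\<dots> \<le> measure_pmf.expectation ?R ?V"
  proof (rule expectation_mono_finite[OF finR])
    fix q assume q: "q \<in> set_pmf ?R"
    have "measure_pmf.expectation (?E q) (\<lambda>r. ?V (fst r, last (snd r)))
        \<le> measure_pmf.expectation (?E q) (potential (D s))"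
    proof (rule expectation_mono_finite[OF finE])
      fix r assume "r \<in> set_pmf (?E q)"
      then have "length (snd r) = Suc m"
        using epoch_invariant[of "fst r" "snd r"] by (metis prod.collapse)
      from potential_final[OF s this, of "fst r"] show "?V (fst r, last (snd r)) \<le> potential (D s) r"
        by simp
    qed
    also have "\<dots> \<le> potential (D s) (fst q, [snd q])"
      using q by (intro expectation_potential_epoch s) auto
    also have "\<dots> = ?V q" by (simp add: potential_def drift_def split_beta)
    finally show "measure_pmf.expectation (?E q) (\<lambda>r. ?V (fst r, last (snd r))) \<le> ?V q" .
  qed
  also have "\<dots> \<le> P x0" using Suc by simp
  finally show ?case .
qed simp

text \<open>The uniform choice of the output turns the sum over the history into a mean, and final
  snapshots lie in \<Omega>, where \<open>P\<close> is at least \<open>P xstar\<close>.\<close>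

lemma output_bound:
  "measure_pmf.expectation (sparse_asylpg_output n f h \<Omega> \<eta> bx b sel D A x0 m S) (\<lambda>x. (norm (G x))\<^sup>2)
    \<le> 2 * L * (P x0 - P xstar) / (\<rho> * (1 - 2 * \<rho>) * real (S * m))"
proof -
  let ?R = "sparse_asylpg n f h \<Omega> \<eta> bx b sel D A x0 m S"
  let ?I = "{..<S} \<times> {..<m}"
  define c where "c = \<rho> * (1 - 2 * \<rho>) / (2 * L)"
  have c: "c > 0" using rho L by (simp add: c_def)
  let ?\<Sigma> = "\<lambda>q. \<Sum>e\<leftarrow>fst q. (norm (G (current e)))\<^sup>2"
  have finR: "finite (set_pmf ?R)" by (intro finite_set_sparse_asylpg finite_set_index) auto
  have I: "finite ?I" "?I \<noteq> {}" "card ?I = S * m" using m S by (auto simp: lessThan_empty_iff)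
  define K where "K q = map_pmf (\<lambda>(s, t). current (fst q ! (s * m + t))) (pmf_of_set ?I)"
    for q :: "'d iteration list \<times> (real ^ 'd)"
  have finK: "finite (set_pmf (K q))" for q
    unfolding K_def set_map_pmf set_pmf_of_set[OF I(2,1)] by simp
  have "sparse_asylpg_output n f h \<Omega> \<eta> bx b sel D A x0 m S = ?R \<bind> K"
    by (simp add: sparse_asylpg_output_def K_def[abs_def] map_pmf_def split_beta')
  then have "measure_pmf.expectation (sparse_asylpg_output n f h \<Omega> \<eta> bx b sel D A x0 m S)
      (\<lambda>x. (norm (G x))\<^sup>2)
    = measure_pmf.expectation ?R (\<lambda>q. measure_pmf.expectation (K q) (\<lambda>x. (norm (G x))\<^sup>2))"
    by (simp add: expectation_bind_finite finR finK)
  also have "\<dots> = measure_pmf.expectation ?R (\<lambda>q. ?\<Sigma> q / real (S * m))"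
  proof (rule expectation_cong)
    fix q assume "q \<in> set_pmf ?R"
    then have "length (fst q) = S * m" using length_sparse_asylpg[of "fst q" "snd q"] by simp
    then show "measure_pmf.expectation (K q) (\<lambda>x. (norm (G x))\<^sup>2) = ?\<Sigma> q / real (S * m)"
      unfolding K_def integral_map_pmf integral_pmf_of_set[OF I(2,1)] I(3)
      by (simp add: sum_list_eq_sum_blocks[of _ S m] split_beta)
  qed
  also have "\<dots> = measure_pmf.expectation ?R ?\<Sigma> / real (S * m)" by simp
  finally have out: "measure_pmf.expectation (sparse_asylpg_output n f h \<Omega> \<eta> bx b sel D A x0 m S)
      (\<lambda>x. (norm (G x))\<^sup>2) = measure_pmf.expectation ?R ?\<Sigma> / real (S * m)" .
  have "P xstar + c * measure_pmf.expectation ?R ?\<Sigma>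
      = measure_pmf.expectation ?R (\<lambda>q. P xstar + c * ?\<Sigma> q)"
    by (simp add: finR)
  also have "\<dots> \<le> measure_pmf.expectation ?R (\<lambda>(hist, xs). P xs
      + \<rho> * (1 - 2 * \<rho>) / (2 * L) * (\<Sum>e\<leftarrow>hist. (norm (G (current e)))\<^sup>2))"
    using optimal snapshot_in_Omega
    by (intro expectation_mono_finite[OF finR]) (auto simp: c_def is_arg_min_linorder)
  also have "\<dots> \<le> P x0" by (rule expectation_sparse_asylpg) simp
  finally have "measure_pmf.expectation ?R ?\<Sigma> \<le> (P x0 - P xstar) / c"
    using c by (simp add: field_simps)
  then have "measure_pmf.expectation ?R ?\<Sigma> / real (S * m) \<le> (P x0 - P xstar) / c / real (S * m)"
    by (rule divide_right_mono) simp
  then show ?thesis unfolding out by (simp add: c_def mult_ac)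
qed

end

theorem theorem3:
  fixes f :: "nat \<Rightarrow> real ^ 'd::finite \<Rightarrow> real"
    and h P :: "real ^ 'd \<Rightarrow> real"
    and \<Omega> :: "(real ^ 'd) set"
    and x0 xstar :: "real ^ 'd"
    and n m S b bx :: nat
    and L \<rho> \<eta> \<mu> \<tau> \<phi> \<Gamma> :: real
    and D :: "nat \<Rightarrow> nat \<Rightarrow> nat"
    and A :: "nat \<Rightarrow> nat \<Rightarrow> nat pmf"
    and sel :: "'d selection"
    and iters :: "'d iteration set"
  assumes "n \<ge> 1" and "m \<ge> 1" and "S \<ge> 1" and "b \<ge> 2" and "bx \<ge> 2"
    and "\<mu> > 0" and "\<tau> > 0" and "L > 0" and "0 < \<rho>" and "\<rho> < 1 / 2"
    and eta: "\<eta> = \<rho> / L"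
    and Omega_convex: "convex \<Omega>"
    and h_convex: "convex_on \<Omega> h"
    and prox_exists: "\<And>x. \<exists>y. is_arg_min (prox_objective \<eta> h x) (\<lambda>y. y \<in> \<Omega>) y"
    and P_def: "P = (\<lambda>x. average n f x + h x)"
    and optimal: "is_arg_min P (\<lambda>x. x \<in> \<Omega>) xstar"
    and x0: "x0 \<in> \<Omega>"
    and differentiable: "\<And>i x. i \<in> {1..n} \<Longrightarrow> x \<in> \<Omega> \<Longrightarrow> f i differentiable (at x)"
    and smooth: "\<And>i x y. i \<in> {1..n} \<Longrightarrow> x \<in> \<Omega> \<Longrightarrow> y \<in> \<Omega> \<Longrightarrow>
                   norm (grad (f i) x - grad (f i) y) \<le> L * norm (x - y)"
    and index_range: "\<And>s t. s < S \<Longrightarrow> t < m \<Longrightarrow> set_pmf (A s t) \<subseteq> {1..n}"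
    and index_unbiased: "\<And>s t x. s < S \<Longrightarrow> t < m \<Longrightarrow> x \<in> \<Omega> \<Longrightarrow>
          measure_pmf.expectation (A s t) (\<lambda>a. grad (f a) x) = grad (average n f) x"
    and delay_index: "\<And>s t. s < S \<Longrightarrow> t < m \<Longrightarrow> D s t \<le> t"
    and delay_bound: "\<And>s t. s < S \<Longrightarrow> t < m \<Longrightarrow> real t - real (D s t) \<le> \<tau>"
    and iters: "iters = possible_iterations n f h \<Omega> \<eta> bx b sel D A x0 m S"
    and model_in_Omega: "\<And>e. e \<in> iters \<Longrightarrow> model e \<in> \<Omega>"
    and model_precision: "\<And>e. e \<in> iters \<Longrightarrow>
          measure_pmf.expectation (model_point bx (stale e) (snapshot e))
              (\<lambda>w. (norm (w - stale e))\<^sup>2)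
            \<le> \<mu> * (norm (stale e - snapshot e))\<^sup>2"
    and probabilities: "\<And>e i. e \<in> iters \<Longrightarrow> 0 \<le> probs e $ i \<and> probs e $ i \<le> 1"
    and budget_pos: "\<And>e. e \<in> iters \<Longrightarrow> budget e > 0"
    and budget_bound: "\<And>e. e \<in> iters \<Longrightarrow> alpha e \<noteq> 0 \<Longrightarrow>
          budget e \<le> norm1 (alpha e) / infnorm (alpha e)"
    and probs_eq: "\<And>e i. e \<in> iters \<Longrightarrow> alpha e \<noteq> 0 \<Longrightarrow>
          probs e $ i = \<bar>alpha e $ i\<bar> * budget e / norm1 (alpha e)"
    and phi: "\<phi> = Min (budget ` iters)"
    and Gamma: "\<Gamma> = (real CARD('d))\<^sup>2 / (4 * \<phi> * (2 ^ (b - 1) - 1)\<^sup>2) + real CARD('d) / \<phi> + 1"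
    and step_condition:
      "8 * \<rho>\<^sup>2 * (real m)\<^sup>2 * (\<mu> + 1) * \<Gamma> + 2 * \<rho>\<^sup>2 * (\<mu> + 1) * \<tau>\<^sup>2 * \<Gamma> + \<rho> \<le> 1"
  shows "measure_pmf.expectation (sparse_asylpg_output n f h \<Omega> \<eta> bx b sel D A x0 m S)
           (\<lambda>x. (norm (gradient_mapping \<eta> h \<Omega> (average n f) x))\<^sup>2)
         \<le> 2 * L * (P x0 - P xstar) / (\<rho> * (1 - 2 * \<rho>) * real (S * m))"
proof -
  interpret sparse_asylpg_run f h P \<Omega> x0 xstar n m S b bx L \<rho> \<eta> \<mu> \<tau> \<phi> \<Gamma> D A sel iters
    by unfold_locales (fact assms)+
  show ?thesis by (rule output_bound)
qed

end
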